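(* Let $X$ and $A$ be finite sets and let $\mathcal U\subseteq\mathbb C^X\otimes\mathbb C^X$ and $\mathcal V\subseteq\mathbb C^A\otimes\mathbb C^A$ be symmetric skew subspaces. Then $\mathcal U\stackrel{\mathrm{loc}}{\to}\mathcal V$ if and only if $\mathcal S_{\mathcal U}\to\mathcal S_{\mathcal V}$.
   Context: Notation: $M_X=\mathcal L(\mathbb C^X)$, $M_{XX}=M_X\otimes M_X$, $(e_x)$ canonical basis, $\xi\eta^*$ the rank one operator $\zeta\mapsto\langle\zeta,\eta\rangle\xi$ (inner products linear in the first variable). For a Hilbert space $H$, $H^{\mathrm d}$ is its Banach dual, $\xi^{\mathrm d}\in H^{\mathrm d}$ is $\xi^{\mathrm d}(\eta)=\langle\eta,\xi\rangle$, and for $T\in\mathcal L(H,K)$, $T^{\mathrm d}:K^{\mathrm d}\to H^{\mathrm d}$ is the dual (adjoint) operator. $\overline T=(T^* )^{\mathrm t}$ is the entrywise conjugate of a matrix $T$. Symmetric skew subspaces: for a finite set $Z$ and $H=\mathbb C^Z$, let $\mathrm m(\zeta)=\langle\zeta,\sum_ze_z\otimes e_z\rangle$ and $\mathfrak f(\xi\otimes\eta)=\eta\otimes\xi$ on $H\otimes H$. A subspace $\mathcal U\subseteq H\otimes H$ is skew if $\mathrm m(\mathcal U)=\{0\}$ and symmetric if $\mathfrak f(\mathcal U)=\mathcal U$. Let $\theta:H\otimes H\to\mathcal L(H^{\mathrm d},H)$ be the linear map $\theta(\xi\otimes\eta)(\zeta^{\mathrm d})=\langle\xi,\zeta\rangle\eta$,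 and $\mathcal S_{\mathcal U}=\theta(\mathcal U)$. For a symmetric skew $\mathcal U$, $\mathcal S_{\mathcal U}$ is a twisted operator anti-system: a subspace $\mathcal S\subseteq\mathcal L(H^{\mathrm d},H)$ such that $T\in\mathcal S$ implies $\mathrm d^{-1}\circ T^*\circ\mathrm d^{-1}\in\mathcal S$ and $\sum_z\langle(T\circ\mathrm d)(e_z),e_z\rangle=0$, where $\mathrm d(\xi)=\xi^{\mathrm d}$. $\mathcal S\to\mathcal T$: for twisted operator anti-systems $\mathcal S\subseteq\mathcal L((\mathbb C^X)^{\mathrm d},\mathbb C^X)$ and $\mathcal T\subseteq\mathcal L((\mathbb C^A)^{\mathrm d},\mathbb C^A)$, write $\mathcal S\to\mathcal T$ if there is a quantum channel $\Phi:M_X\to M_A$, $\Phi(T)=\sum_{i=1}^mM_iTM_i^*$, such that $\overline M_j\,\mathcal S\,M_i^{\mathrm d}\subseteq\mathcal T$ for all $i,j=1,\dots,m$. $\mathcal U\stackrel{\mathrm{loc}}{\to}\mathcal V$: there is a locally tracial QNS correlation $\Gamma:M_{XX}\to M_{AA}$ such that $\langle\Gamma(P_{\mathcal U}),P_{\mathcal V_\perp}\rangle=0$. Here $P_{\mathcal U}$ is the orthogonal projection onto $\mathcal U$; $\mathcal V_\perp$ is the annihilator of $\mathcal V$ in $(\mathbb C^A\otimes\mathbb C^A)^{\mathrm d}$ and $P_{\mathcal V_\perp}$ the orthogonal projection onto it, so $P_{\mathcal V_\perp}=(I-P_{\mathcal V})^{\mathrm d}$; the pairing is $\langle\rho,\omega^{\mathrm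 d}\rangle=\mathrm{Tr}(\rho\omega)$, so that the condition reads $\mathrm{Tr}(\Gamma(P_{\mathcal U})(I-P_{\mathcal V}))=0$. Locally tracial QNS correlations: a QNS correlation is a completely positive trace preserving map $\Gamma:M_{XX}\to M_{AA}$ such that the partial trace over the first (resp. second) factor of $\Gamma(\rho_1\otimes\rho_2)$ vanishes whenever $\mathrm{Tr}\rho_1=0$ (resp. $\mathrm{Tr}\rho_2=0$). It is locally tracial if there exist a unital abelian C*-algebra $\mathcal A$, a state $\tau$ on $\mathcal A$ and a positive element $(g_{x,x',a,a'})\in M_X\otimes M_A\otimes\mathcal A$ with $\sum_ag_{x,x',a,a}=\delta_{x,x'}1$ for all $x,x'$, such that $\Gamma(e_xe_{x'}^*\otimes e_ye_{y'}^* )=\sum_{a,a',b,b'}\tau(g_{x,x',a,a'}g_{y',y,b',b})\,e_ae_{a'}^*\otimes e_be_{b'}^*$ (equivalently, $\Gamma$ is given by a trace on the universal C*-algebra of a stochastic operator matrix factoring through a unital *-homomorphism into an abelian C*-algebra). *)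

theory Defs
  imports "HOL-Analysis.Analysis" "HOL-Algebra.Module"
begin

subsection \<open>Matrices and vectors over finite index types\<close>

text \<open>
  For finite types \<open>'x\<close> and \<open>'a\<close>, the Hilbert space of the finite set \<open>'x\<close> is \<open>complex^'x\<close>, its
  tensor square is \<open>complex^('x \<times> 'x)\<close>, the operators from \<open>complex^'x\<close> to \<open>complex^'a\<close> are the
  matrices \<open>complex^'x^'a\<close>, and \<open>axis x 1\<close> is the basis vector at \<open>x\<close>.  Subspaces are complex
  subspaces, \<open>vec.subspace\<close>.
\<close>

definition cinner :: "complex^'n \<Rightarrow> complex^'n \<Rightarrow> complex" where
  "cinner \<xi> \<eta> = (\<Sum>i\<in>UNIV. \<xi> $ i * cnj (\<eta> $ i))"

definition adj :: "complex^'n^'m \<Rightarrow> complex^'m^'n" where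
  "adj M = (\<chi> i j. cnj (M $ j $ i))"

definition conj_mat :: "complex^'n^'m \<Rightarrow> complex^'n^'m" where
  "conj_mat M = transpose (adj M)"

text \<open>The library operation \<open>*s\<close> is scalar multiplication on vectors only.\<close>
definition mat_scale :: "complex \<Rightarrow> complex^'n^'m \<Rightarrow> complex^'n^'m" (infixr "*\<^sub>m" 75) where
  "c *\<^sub>m M = (\<chi> i j. c * M $ i $ j)"

definition rank_one :: "complex^'m \<Rightarrow> complex^'n \<Rightarrow> complex^'n^'m" where
  "rank_one \<xi> \<eta> = (\<chi> i j. \<xi> $ i * cnj (\<eta> $ j))"

lemma rank_one_apply: "rank_one \<xi> \<eta> *v \<zeta> = cinner \<zeta> \<eta> *s \<xi>"
  by (simp add: vec_eq_iff rank_one_def cinner_def matrix_vector_mult_def sum_distrib_left mult_ac)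

abbreviation mat_unit :: "'n::finite \<Rightarrow> 'n \<Rightarrow> complex^'n^'n" where
  "mat_unit i j \<equiv> rank_one (axis i 1) (axis j 1)"

definition vec_tensor :: "complex^'m \<Rightarrow> complex^'n \<Rightarrow> complex^('m \<times> 'n)" (infixr "\<otimes>\<^sub>v" 70) where
  "\<xi> \<otimes>\<^sub>v \<eta> = (\<chi> k. \<xi> $ fst k * \<eta> $ snd k)"

definition mat_tensor ::
    "complex^'n^'n \<Rightarrow> complex^'m^'m \<Rightarrow> complex^('n \<times> 'm)^('n \<times> 'm)" (infixr "\<otimes>\<^sub>m" 70) where
  "S \<otimes>\<^sub>m T = (\<chi> k l. S $ fst k $ fst l * T $ snd k $ snd l)"

text \<open>\<open>ptrace_fst\<close> traces out the first tensor factor, \<open>ptrace_snd\<close> the second.\<close>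
definition ptrace_fst :: "complex^('n::finite \<times> 'm::finite)^('n \<times> 'm) \<Rightarrow> complex^'m^'m" where
  "ptrace_fst R = (\<chi> b b'. \<Sum>a\<in>UNIV. R $ (a, b) $ (a, b'))"

definition ptrace_snd :: "complex^('n::finite \<times> 'm::finite)^('n \<times> 'm) \<Rightarrow> complex^'n^'n" where
  "ptrace_snd R = (\<chi> a a'. \<Sum>b\<in>UNIV. R $ (a, b) $ (a', b))"

text \<open>Orthogonal projection onto \<open>W\<close> with respect to the inner product \<open>ip\<close>.\<close>
definition orth_proj :: "('v::ab_group_add \<Rightarrow> 'v \<Rightarrow> complex) \<Rightarrow> 'v set \<Rightarrow> 'v \<Rightarrow> 'v" where
  "orth_proj ip W v = (THE p. p \<in> W \<and> (\<forall>w\<in>W. ip (v - p) w = 0))"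

definition proj_mat :: "(complex^'n) set \<Rightarrow> complex^'n^'n" where
  "proj_mat U = matrix (orth_proj cinner U)"


subsection \<open>The dual space\<close>

typedef ('n::finite) dual = "{f :: complex^'n \<Rightarrow> complex. Vector_Spaces.linear (*s) (*) f}"
  morphisms dual_apply Dual
proof
  have "vector_space ((*) :: complex \<Rightarrow> complex \<Rightarrow> complex)"
    by unfold_locales (simp_all add: algebra_simps)
  then show "(\<lambda>_. 0) \<in> {f :: complex^'n \<Rightarrow> complex. Vector_Spaces.linear (*s) (*) f}"
    by (simp add: Vector_Spaces.linear_iff vec.vector_space_axioms)
qed

setup_lifting type_definition_dual

lemma functional_iff:
  "Vector_Spaces.linear (*s) (*) (f :: complex^'n \<Rightarrow> complex) \<longleftrightarrow>
     (\<forall>x y. f (x + y) = f x + f y) \<and> (\<forall>c x. f (c *s x) = c * f x)"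
proof -
  have "vector_space ((*) :: complex \<Rightarrow> complex \<Rightarrow> complex)"
    by unfold_locales (simp_all add: algebra_simps)
  then show ?thesis
    by (simp add: Vector_Spaces.linear_iff vec.vector_space_axioms)
qed

instantiation dual :: (finite) ab_group_add
begin

lift_definition zero_dual :: "'a dual" is "\<lambda>_. 0"
  by (simp add: functional_iff)
lift_definition plus_dual :: "'a dual \<Rightarrow> 'a dual \<Rightarrow> 'a dual" is "\<lambda>f g x. f x + g x"
  by (simp add: functional_iff algebra_simps)
lift_definition minus_dual :: "'a dual \<Rightarrow> 'a dual \<Rightarrow> 'a dual" is "\<lambda>f g x. f x - g x"
  by (simp add: functional_iff algebra_simps)
lift_definition uminus_dual :: "'a dual \<Rightarrow> 'a dual" is "\<lambda>f x. - f x"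
  by (simp add: functional_iff)

instance
  by standard (transfer; simp add: fun_eq_iff)+

end

lift_definition dual_vec :: "complex^'n::finite \<Rightarrow> 'n dual" is "\<lambda>\<xi> \<eta>. cinner \<eta> \<xi>"
  by (simp add: functional_iff cinner_def sum.distrib sum_distrib_left algebra_simps)

lift_definition dual_op :: "complex^'n::finite^'m::finite \<Rightarrow> 'm dual \<Rightarrow> 'n dual"
  is "\<lambda>T \<phi> x. \<phi> (T *v x)"
  by (simp add: functional_iff matrix_vector_right_distrib vec.scale)

text \<open>The Hilbert space structure of the dual, for which the conjugate-linear bijection
  \<open>dual_vec\<close> reverses inner products.\<close>
definition dual_inner :: "'n::finite dual \<Rightarrow> 'n dual \<Rightarrow> complex" where
  "dual_inner \<phi> \<psi> = (\<Sum>i\<in>UNIV. dual_apply \<phi> (axis i 1) * cnj (dual_apply \<psi> (axis i 1)))"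

lemma cinner_axis_left: "cinner (axis i 1) \<eta> = cnj (\<eta> $ i)"
proof -
  have "cinner (axis i 1) \<eta> = (\<Sum>j\<in>UNIV. if j = i then cnj (\<eta> $ j) else 0)"
    unfolding cinner_def by (rule sum.cong) (auto simp: axis_def)
  then show ?thesis by simp
qed

lemma dual_inner_dual_vec: "dual_inner (dual_vec \<xi>) (dual_vec \<eta>) = cinner \<eta> \<xi>"
  by (simp add: dual_inner_def dual_vec.rep_eq cinner_axis_left)
     (simp add: cinner_def mult.commute)

definition annihilator :: "(complex^'n::finite) set \<Rightarrow> 'n dual set" where
  "annihilator V = {\<phi>. \<forall>v\<in>V. dual_apply \<phi> v = 0}"

text \<open>The matrix \<open>\<omega>\<close> with \<open>dual_op \<omega> = W\<close>, for an operator \<open>W\<close> on the dual.\<close>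
definition predual_op :: "('n::finite dual \<Rightarrow> 'n dual) \<Rightarrow> complex^'n^'n" where
  "predual_op W = (\<chi> i j. dual_apply (W (dual_vec (axis i 1))) (axis j 1))"

lemma predual_op_dual_op:
  fixes \<omega> :: "complex^'n::finite^'n"
  shows "predual_op (dual_op \<omega>) = \<omega>"
proof -
  have "cinner \<xi> (axis i 1) = \<xi> $ i" for \<xi> :: "complex^'n" and i
  proof -
    have "cinner \<xi> (axis i 1) = (\<Sum>j\<in>UNIV. if j = i then \<xi> $ j else 0)"
      unfolding cinner_def by (rule sum.cong) (auto simp: axis_def)
    then show ?thesis by simp
  qed
  then show ?thesis
    by (simp add: predual_op_def vec_eq_iff dual_op.rep_eq dual_vec.rep_eq)
       (simp add: matrix_vector_mult_def axis_def if_distrib cong: if_cong)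
qed

definition dual_pairing :: "complex^'n::finite^'n \<Rightarrow> ('n dual \<Rightarrow> 'n dual) \<Rightarrow> complex" where
  "dual_pairing \<rho> W = trace (\<rho> ** predual_op W)"

lemma dual_pairing_dual_op: "dual_pairing \<rho> (dual_op \<omega>) = trace (\<rho> ** \<omega>)"
  by (simp add: dual_pairing_def predual_op_dual_op)


subsection \<open>Symmetric skew subspaces\<close>

definition max_ent_functional :: "complex^('z::finite \<times> 'z) \<Rightarrow> complex" where
  "max_ent_functional \<zeta> = cinner \<zeta> (\<Sum>z\<in>UNIV. axis z 1 \<otimes>\<^sub>v axis z 1)"

definition flip :: "complex^('z::finite \<times> 'z) \<Rightarrow> complex^('z \<times> 'z)" where
  "flip u = (\<chi> k. u $ (snd k, fst k))"

lemma flip_tensor: "flip (\<xi> \<otimes>\<^sub>v \<eta>) = \<eta> \<otimes>\<^sub>v \<xi>"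
  by (simp add: flip_def vec_tensor_def vec_eq_iff)

definition skew :: "(complex^('z::finite \<times> 'z)) set \<Rightarrow> bool" where
  "skew U \<longleftrightarrow> max_ent_functional ` U = {0}"

definition symmetric :: "(complex^('z::finite \<times> 'z)) set \<Rightarrow> bool" where
  "symmetric U \<longleftrightarrow> flip ` U = U"

definition symmetric_skew_subspace :: "(complex^('z::finite \<times> 'z)) set \<Rightarrow> bool" where
  "symmetric_skew_subspace U \<longleftrightarrow> vec.subspace U \<and> symmetric U \<and> skew U"

text \<open>The linear extension of its values on elementary tensors, see \<open>theta_tensor\<close> below.\<close>
definition theta :: "complex^('z::finite \<times> 'z) \<Rightarrow> 'z dual \<Rightarrow> complex^'z" where
  "theta u \<phi> = (\<Sum>(i, j)\<in>UNIV. (u $ (i, j) * dual_apply \<phi> (axis i 1)) *s axis j 1)"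

lemma theta_nth: "theta u \<phi> $ j = (\<Sum>i\<in>UNIV. u $ (i, j) * dual_apply \<phi> (axis i 1))"
proof -
  have "theta u \<phi> $ j =
      (\<Sum>i\<in>UNIV. \<Sum>k\<in>UNIV. if k = j then u $ (i, k) * dual_apply \<phi> (axis i 1) else 0)"
    unfolding theta_def UNIV_Times_UNIV[symmetric] sum.cartesian_product[symmetric]
    unfolding sum_component by (intro sum.cong) (simp_all add: axis_def)
  then show ?thesis by simp
qed

lemma theta_tensor: "theta (\<xi> \<otimes>\<^sub>v \<eta>) (dual_vec \<zeta>) = cinner \<xi> \<zeta> *s \<eta>"
  by (simp add: vec_eq_iff theta_nth vec_tensor_def dual_vec.rep_eq cinner_axis_left)
     (simp add: cinner_def sum_distrib_left mult_ac)

lemma theta_add: "theta (u + v) \<phi> = theta u \<phi> + theta v \<phi>"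
  by (simp add: vec_eq_iff theta_nth sum.distrib algebra_simps)

lemma theta_scale: "theta (c *s u) \<phi> = c *s theta u \<phi>"
  by (simp add: vec_eq_iff theta_nth sum_distrib_left algebra_simps)

definition antisystem_of :: "(complex^('z::finite \<times> 'z)) set \<Rightarrow> ('z dual \<Rightarrow> complex^'z) set" where
  "antisystem_of U = theta ` U"


subsection \<open>Quantum channels and homomorphisms of operator anti-systems\<close>

definition mat_linear :: "(complex^'n^'n \<Rightarrow> complex^'m^'m) \<Rightarrow> bool" where
  "mat_linear F \<longleftrightarrow> Vector_Spaces.linear (*\<^sub>m) (*\<^sub>m) F"

text \<open>Positivity of the \<open>n\<close> by \<open>n\<close> block matrix with blocks \<open>R i j\<close>.\<close>
definition block_positive :: "nat \<Rightarrow> (nat \<Rightarrow> nat \<Rightarrow> complex^'n^'n) \<Rightarrow> bool" where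
  "block_positive n R \<longleftrightarrow>
     (\<forall>v :: nat \<Rightarrow> complex^'n. (\<Sum>i<n. \<Sum>j<n. cinner (R i j *v v j) (v i)) \<in> \<real>\<^sub>\<ge>\<^sub>0)"

definition completely_positive :: "(complex^'n^'n \<Rightarrow> complex^'m^'m) \<Rightarrow> bool" where
  "completely_positive F \<longleftrightarrow> mat_linear F \<and>
     (\<forall>n R. block_positive n R \<longrightarrow> block_positive n (\<lambda>i j. F (R i j)))"

definition quantum_channel :: "(complex^'n^'n \<Rightarrow> complex^'m^'m) \<Rightarrow> bool" where
  "quantum_channel F \<longleftrightarrow> completely_positive F \<and> (\<forall>T. trace (F T) = trace T)"

text \<open>The relation \<open>\<S> \<rightarrow> \<T>\<close>; the Kraus operators are \<open>M 0, \<dots>, M (m - 1)\<close>.\<close>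
definition antisystem_hom ::
    "('x::finite dual \<Rightarrow> complex^'x) set \<Rightarrow> ('a::finite dual \<Rightarrow> complex^'a) set \<Rightarrow> bool" where
  "antisystem_hom \<S> \<T> \<longleftrightarrow>
     (\<exists>(F :: complex^'x^'x \<Rightarrow> complex^'a^'a) m (M :: nat \<Rightarrow> complex^'x^'a).
        quantum_channel F \<and> (\<forall>T. F T = (\<Sum>i<m. M i ** T ** adj (M i))) \<and>
        (\<forall>i<m. \<forall>j<m. \<forall>S\<in>\<S>. (*v) (conj_mat (M j)) \<circ> S \<circ> dual_op (M i) \<in> \<T>))"


subsection \<open>Abelian C*-algebras\<close>

definition complex_field :: "complex ring" where
  "complex_field = \<lparr>carrier = UNIV, mult = (*), one = 1, zero = 0, add = (+)\<rparr>"

record 'c normed_star_algebra = "(complex, 'c) module" +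
  star :: "'c \<Rightarrow> 'c"
  nrm :: "'c \<Rightarrow> real"

locale unital_cstar_algebra =
  Module.module complex_field C + Ring.ring C for C :: "'c normed_star_algebra" (structure) +
  assumes smult_mult_left: "x \<in> carrier C \<Longrightarrow> y \<in> carrier C \<Longrightarrow>
      (c \<odot>\<^bsub>C\<^esub> x) \<otimes>\<^bsub>C\<^esub> y = c \<odot>\<^bsub>C\<^esub> (x \<otimes>\<^bsub>C\<^esub> y)"
    and smult_mult_right: "x \<in> carrier C \<Longrightarrow> y \<in> carrier C \<Longrightarrow>
      x \<otimes>\<^bsub>C\<^esub> (c \<odot>\<^bsub>C\<^esub> y) = c \<odot>\<^bsub>C\<^esub> (x \<otimes>\<^bsub>C\<^esub> y)"
    and star_closed: "x \<in> carrier C \<Longrightarrow> star C x \<in> carrier C"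
    and star_star: "x \<in> carrier C \<Longrightarrow> star C (star C x) = x"
    and star_add: "x \<in> carrier C \<Longrightarrow> y \<in> carrier C \<Longrightarrow>
      star C (x \<oplus>\<^bsub>C\<^esub> y) = star C x \<oplus>\<^bsub>C\<^esub> star C y"
    and star_smult: "x \<in> carrier C \<Longrightarrow> star C (c \<odot>\<^bsub>C\<^esub> x) = cnj c \<odot>\<^bsub>C\<^esub> star C x"
    and star_mult: "x \<in> carrier C \<Longrightarrow> y \<in> carrier C \<Longrightarrow>
      star C (x \<otimes>\<^bsub>C\<^esub> y) = star C y \<otimes>\<^bsub>C\<^esub> star C x"
    and nrm_nonneg: "x \<in> carrier C \<Longrightarrow> 0 \<le> nrm C x"
    and nrm_eq_0: "x \<in> carrier C \<Longrightarrow> nrm C x = 0 \<longleftrightarrow> x = \<zero>\<^bsub>C\<^esub>"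
    and nrm_triangle: "x \<in> carrier C \<Longrightarrow> y \<in> carrier C \<Longrightarrow>
      nrm C (x \<oplus>\<^bsub>C\<^esub> y) \<le> nrm C x + nrm C y"
    and nrm_smult: "x \<in> carrier C \<Longrightarrow> nrm C (c \<odot>\<^bsub>C\<^esub> x) = cmod c * nrm C x"
    and nrm_mult: "x \<in> carrier C \<Longrightarrow> y \<in> carrier C \<Longrightarrow>
      nrm C (x \<otimes>\<^bsub>C\<^esub> y) \<le> nrm C x * nrm C y"
    and cstar_identity: "x \<in> carrier C \<Longrightarrow> nrm C (star C x \<otimes>\<^bsub>C\<^esub> x) = (nrm C x)\<^sup>2"
    and complete: "range s \<subseteq> carrier C \<Longrightarrow>
      (\<forall>\<epsilon>>0. \<exists>N. \<forall>m\<ge>N. \<forall>n\<ge>N. nrm C (s m \<ominus>\<^bsub>C\<^esub> s n) < \<epsilon>) \<Longrightarrow>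
      \<exists>x\<in>carrier C. (\<lambda>n. nrm C (s n \<ominus>\<^bsub>C\<^esub> x)) \<longlonglongrightarrow> 0"

locale abelian_cstar_algebra = unital_cstar_algebra C for C :: "'c normed_star_algebra" (structure) +
  assumes abelian: "x \<in> carrier C \<Longrightarrow> y \<in> carrier C \<Longrightarrow> x \<otimes>\<^bsub>C\<^esub> y = y \<otimes>\<^bsub>C\<^esub> x"

definition cstar_state :: "'c normed_star_algebra \<Rightarrow> ('c \<Rightarrow> complex) \<Rightarrow> bool" where
  "cstar_state C \<tau> \<longleftrightarrow>
     (\<forall>x\<in>carrier C. \<forall>y\<in>carrier C. \<tau> (x \<oplus>\<^bsub>C\<^esub> y) = \<tau> x + \<tau> y) \<and>
     (\<forall>c. \<forall>x\<in>carrier C. \<tau> (c \<odot>\<^bsub>C\<^esub> x) = c * \<tau> x) \<and>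
     (\<forall>x\<in>carrier C. \<tau> (star C x \<otimes>\<^bsub>C\<^esub> x) \<in> \<real>\<^sub>\<ge>\<^sub>0) \<and>
     \<tau> \<one>\<^bsub>C\<^esub> = 1"

text \<open>
  An element of the C*-algebra \<open>M_X \<otimes> M_A \<otimes> \<A>\<close> is given by its entries \<open>g x x' a a'\<close> in \<open>\<A>\<close>, the
  coefficients of \<open>e_x e_x'^* \<otimes> e_a e_a'^*\<close>.  It is positive iff it has the form \<open>h^* h\<close>.
\<close>
definition positive_element ::
    "'c normed_star_algebra \<Rightarrow> ('x::finite \<Rightarrow> 'x \<Rightarrow> 'a::finite \<Rightarrow> 'a \<Rightarrow> 'c) \<Rightarrow> bool" where
  "positive_element C g \<longleftrightarrow>
     (\<exists>h :: 'x \<Rightarrow> 'x \<Rightarrow> 'a \<Rightarrow> 'a \<Rightarrow> 'c. (\<forall>x x' a a'. h x x' a a' \<in> carrier C) \<and>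
        (\<forall>x x' a a'. g x x' a a' =
           (\<Oplus>\<^bsub>C\<^esub>p\<in>UNIV. star C (h (fst p) x (snd p) a) \<otimes>\<^bsub>C\<^esub> h (fst p) x' (snd p) a')))"


subsection \<open>Locally tracial QNS correlations\<close>

definition QNS_correlation ::
    "(complex^('x::finite \<times> 'x)^('x \<times> 'x) \<Rightarrow> complex^('a::finite \<times> 'a)^('a \<times> 'a)) \<Rightarrow> bool" where
  "QNS_correlation \<Gamma> \<longleftrightarrow> quantum_channel \<Gamma> \<and>
     (\<forall>\<rho>\<^sub>1 \<rho>\<^sub>2. trace \<rho>\<^sub>1 = 0 \<longrightarrow> ptrace_fst (\<Gamma> (\<rho>\<^sub>1 \<otimes>\<^sub>m \<rho>\<^sub>2)) = 0) \<and>
     (\<forall>\<rho>\<^sub>1 \<rho>\<^sub>2. trace \<rho>\<^sub>2 = 0 \<longrightarrow> ptrace_snd (\<Gamma> (\<rho>\<^sub>1 \<otimes>\<^sub>m \<rho>\<^sub>2)) = 0)"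

text \<open>
  HOL cannot quantify over types inside a formula, so the type \<open>'u\<close> from which the carrier of the
  abelian C*-algebra is drawn is a parameter.  It should be instantiated by a type \<open>'c + complex\<close>
  with \<open>'c\<close> arbitrary: an algebra carried by any type \<open>'c\<close> can be transported to \<open>'c + complex\<close>, so a
  statement made for all \<open>'c\<close> places no restriction on the algebra; and \<open>'c + complex\<close> always has
  room for a nonzero algebra, also when \<open>'c\<close> is small.
\<close>
definition locally_tracial ::
    "'u itself \<Rightarrow>
     (complex^('x::finite \<times> 'x)^('x \<times> 'x) \<Rightarrow> complex^('a::finite \<times> 'a)^('a \<times> 'a)) \<Rightarrow> bool" where
  "locally_tracial _ \<Gamma> \<longleftrightarrow>
     (\<exists>(C :: 'u normed_star_algebra) \<tau> (g :: 'x \<Rightarrow> 'x \<Rightarrow> 'a \<Rightarrow> 'a \<Rightarrow> 'u).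
        abelian_cstar_algebra C \<and> cstar_state C \<tau> \<and>
        positive_element C g \<and>
        (\<forall>x x'. (\<Oplus>\<^bsub>C\<^esub>a\<in>UNIV. g x x' a a) = (if x = x' then \<one>\<^bsub>C\<^esub> else \<zero>\<^bsub>C\<^esub>)) \<and>
        (\<forall>x x' y y'. \<Gamma> (mat_unit x x' \<otimes>\<^sub>m mat_unit y y') =
           (\<Sum>a\<in>UNIV. \<Sum>a'\<in>UNIV. \<Sum>b\<in>UNIV. \<Sum>b'\<in>UNIV.
              \<tau> (g x x' a a' \<otimes>\<^bsub>C\<^esub> g y' y b' b) *\<^sub>m (mat_unit a a' \<otimes>\<^sub>m mat_unit b b'))))"

definition loc_hom ::
    "'u itself \<Rightarrow> (complex^('x::finite \<times> 'x)) set \<Rightarrow> (complex^('a::finite \<times> 'a)) set \<Rightarrow> bool" where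
  "loc_hom TU U V \<longleftrightarrow>
     (\<exists>\<Gamma>. QNS_correlation \<Gamma> \<and> locally_tracial TU \<Gamma> \<and>
        dual_pairing (\<Gamma> (proj_mat U)) (orth_proj dual_inner (annihilator V)) = 0)"

end

theory Submission
  imports Defs
begin

text \<open>
  Under \<open>theta\<close>, the operation \<open>S \<mapsto> conj_mat N \<circ> S \<circ> dual_op M\<close> becomes the action of
  \<open>M \<otimes> conj N\<close> on \<open>complex^('x \<times> 'x)\<close>, so \<open>antisystem_hom\<close> asks for a channel with Kraus operators \<open>M\<^sub>i\<close>
  such that every \<open>M\<^sub>i \<otimes> conj M\<^sub>j\<close> maps \<open>U\<close> into \<open>V\<close>.  Then \<open>\<Sum>\<^sub>i\<^sub>j (M\<^sub>i \<otimes> conj M\<^sub>j) \<rho> (M\<^sub>i \<otimes> conj M\<^sub>j)\<^sup>*\<close> is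
  a locally tracial correlation over the algebra \<open>\<complex>\<close>, whose \<open>g\<close> is the Choi matrix of the channel.

  Conversely, write \<open>g = h\<^sup>* h\<close>.  The number \<open>Tr (\<Gamma> P\<^sub>U (I - P\<^sub>V))\<close> is a sum of values
  \<open>\<tau> (k\<^sup>* k)\<close>, so \<open>\<tau> (k\<^sup>* k) = 0\<close> for each of these \<open>k\<close>, and an abelian algebra has a character that
  vanishes on all \<open>k\<close> with \<open>\<tau> (k\<^sup>* k) = 0\<close>.  Applied to \<open>h\<close>, it yields the Kraus operators.  The
  character is obtained without Gelfand theory, from a maximal proper cone (containing all squares)
  of selfadjoint elements.
\<close>

subsection \<open>Orthogonal projections and the dual space\<close>

text \<open>The state may mix many characters, so no single Kraus family can be read off from its
  values; only a vanishing condition passes from it to one character, and finitely many elements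
  have to vanish under the same one. Sums of squares supply the condition. A product of two entries
  of \<open>g\<close> contains four entries of \<open>h\<close>; commutativity regroups them as
  \<open>e^* e'\<close>, and the swapped indices in \<open>g y' y b' b\<close> put the stars where
  this needs them. Since \<open>P = P P^*\<close> and \<open>Q = Q Q^*\<close>, where P projects
  onto \<open>U\<close> and \<open>Q = 1 - P_V\<close>, the trace folds into values of the state at
  squares of linear combinations of the \<open>e\<close>. The character maps such a combination to
  the conjugate of an entry of \<open>Q (M_p \<otimes> conj M_q) P\<close>. Zorn's lemma on cones
  takes the place of compactness of the spectrum. The main analytic input is that
  \<open>M - b\<close> is a square for selfadjoint b of norm below M, which a contraction argument
  provides.\<close>

lemma sum_UNIV_prod: "(\<Sum>k\<in>(UNIV :: ('m::finite \<times> 'n::finite) set). f k) = (\<Sum>a\<in>UNIV. \<Sum>b\<in>UNIV. f (a, b))"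
  by (simp add: sum.cartesian_product)

lemma cinner_diff_left: "cinner (x - y) z = cinner x z - cinner y z"
  by (simp add: cinner_def left_diff_distrib sum_subtractf)

lemma cinner_diff_right: "cinner x (y - z) = cinner x y - cinner x z"
  by (simp add: cinner_def right_diff_distrib sum_subtractf)

lemma cinner_scale_right: "cinner x (c *s y) = cnj c * cinner x y"
  by (simp add: cinner_def sum_distrib_left mult_ac)

lemma cinner_commute: "cinner y x = cnj (cinner x y)"
  by (simp add: cinner_def mult.commute)

lemma matrix_vector_mult_axis: "(M *v axis i 1) $ j = (M $ j $ i :: complex)"
  by (simp add: matrix_vector_mult_def axis_def if_distrib cong: if_cong)

lemma cinner_adj: "cinner (M *v x) y = cinner x (adj M *v y)"
  by (simp add: cinner_def adj_def matrix_vector_mult_def sum_distrib_left sum_distrib_right mult_ac)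
     (rule sum.swap)

lemma Re_cinner: "Re (cinner x y) = inner x y"
  by (simp add: cinner_def inner_vec_def inner_complex_def)

lemma cinner_self_eq_0: "cinner x x = 0 \<Longrightarrow> x = 0"
  using Re_cinner[of x x] by simp

text \<open>Two candidates differ by an element of \<open>W\<close> that is orthogonal to itself.
  The inner product is a parameter because both \<open>cinner\<close> and \<open>dual_inner\<close>
  are served.\<close>

lemma orth_proj_eqI:
  assumes "\<And>x y z. ip (x - y) z = ip x z - ip y z" and def: "\<And>x. ip x x = 0 \<Longrightarrow> x = 0"
    and W: "\<And>x y. x \<in> W \<Longrightarrow> y \<in> W \<Longrightarrow> x - y \<in> W"
    and p: "p \<in> W" "\<And>w. w \<in> W \<Longrightarrow> ip (v - p) w = 0"
  shows "orth_proj ip W v = p"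
  unfolding orth_proj_def
proof (rule the_equality)
  show "p \<in> W \<and> (\<forall>w\<in>W. ip (v - p) w = 0)" using p by blast
  fix q assume q: "q \<in> W \<and> (\<forall>w\<in>W. ip (v - q) w = 0)"
  have "ip (q - p) (q - p) = ip ((v - p) - (v - q)) (q - p)" by simp
  also have "\<dots> = ip (v - p) (q - p) - ip (v - q) (q - p)" by (rule assms(1))
  also have "\<dots> = 0" using q p W by simp
  finally show "q = p" using def[of "q - p"] by simp
qed

lemma orth_proj_cinner_eqI:
  assumes "vec.subspace W" "p \<in> W" "\<And>w. w \<in> W \<Longrightarrow> cinner (v - p) w = 0"
  shows "orth_proj cinner W v = p"
  using assms by (intro orth_proj_eqI) (auto simp: cinner_diff_left cinner_self_eq_0 vec.subspace_diff)

text \<open>Existence comes from the real orthogonal decomposition. As \<open>W\<close> is stable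
  under multiplication by the imaginary unit, real orthogonality to \<open>w\<close> and to
  \<open>\<i> *s w\<close> gives complex orthogonality.\<close>

lemma orth_proj_cinner:
  fixes W :: "(complex^'n) set"
  assumes W: "vec.subspace W"
  shows "orth_proj cinner W v \<in> W" and "w \<in> W \<Longrightarrow> cinner (v - orth_proj cinner W v) w = 0"
proof -
  have sc: "c *s x \<in> W" if "x \<in> W" for c x using W that by (rule vec.subspace_scale)
  have "r *\<^sub>R x = complex_of_real r *s x" for r and x :: "complex^'n"
    by (simp add: vec_eq_iff scaleR_conv_of_real[where 'a = complex])
  then have "subspace W"
    unfolding subspace_def using W sc by (auto simp: vec.subspace_0 vec.subspace_add)
  then have span: "span W = W" by (rule span_eq_iff[THEN iffD2])
  obtain p z where p: "p \<in> W" and z: "\<And>w. w \<in> W \<Longrightarrow> orthogonal z w" and v: "v = p + z"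
    using orthogonal_subspace_decomp_exists[of W v] unfolding span by blast
  have *: "cinner z w = 0" if "w \<in> W" for w
  proof (rule complex_eqI)
    show "Re (cinner z w) = Re 0" using z[OF that] by (simp add: Re_cinner orthogonal_def)
    have "Re (cinner z (\<i> *s w)) = 0" using z[OF sc[OF that]] by (simp add: Re_cinner orthogonal_def)
    then show "Im (cinner z w) = Im 0" by (simp add: cinner_scale_right)
  qed
  then have "orth_proj cinner W v = p" using p v W by (intro orth_proj_cinner_eqI) auto
  then show "orth_proj cinner W v \<in> W" and "w \<in> W \<Longrightarrow> cinner (v - orth_proj cinner W v) w = 0"
    using p v * by auto
qed

lemma cinner_eqI: "(\<And>y. cinner x y = cinner x' y) \<Longrightarrow> x = x'"
  using cinner_self_eq_0[of "x - x'"] by (simp add: cinner_diff_left)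

context
  fixes W :: "(complex^'n) set"
  assumes W: "vec.subspace W"
begin

lemma proj_mat_apply: "proj_mat W *v v = orth_proj cinner W v"
proof -
  have "Vector_Spaces.linear (*s) (*s) (orth_proj cinner W)"
  proof (intro Vector_Spaces.linear_iff[THEN iffD2] conjI allI vec.vector_space_axioms)
    note p = orth_proj_cinner[OF W]
    fix x y :: "complex^'n" and c :: complex
    show "orth_proj cinner W (x + y) = orth_proj cinner W x + orth_proj cinner W y"
    proof (rule orth_proj_cinner_eqI[OF W])
      fix w assume w: "w \<in> W"
      have "cinner (x + y - (orth_proj cinner W x + orth_proj cinner W y)) w =
        cinner (x - orth_proj cinner W x - (orth_proj cinner W y - y)) w" by (simp add: algebra_simps)
      also have "\<dots> = 0" using p(2)[OF w, of x] p(2)[OF w, of y] by (simp add: cinner_diff_left)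
      finally show "cinner (x + y - (orth_proj cinner W x + orth_proj cinner W y)) w = 0" .
    qed (simp add: p vec.subspace_add[OF W])
    show "orth_proj cinner W (c *s x) = c *s orth_proj cinner W x"
    proof (rule orth_proj_cinner_eqI[OF W])
      fix w assume w: "w \<in> W"
      have "cinner (c *s x - c *s orth_proj cinner W x) w = c * cinner (x - orth_proj cinner W x) w"
        by (simp add: cinner_def sum_distrib_left algebra_simps)
      with p(2)[OF w] show "cinner (c *s x - c *s orth_proj cinner W x) w = 0" by simp
    qed (simp add: p vec.subspace_scale[OF W])
  qed
  then show ?thesis unfolding proj_mat_def by (rule matrix_works)
qed

lemma proj_mat_in: "proj_mat W *v v \<in> W"
  using orth_proj_cinner[OF W] by (simp add: proj_mat_apply)

lemma proj_mat_eq_iff: "proj_mat W *v v = v \<longleftrightarrow> v \<in> W"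
proof
  assume "v \<in> W"
  then show "proj_mat W *v v = v"
    unfolding proj_mat_apply by (intro orth_proj_cinner_eqI W) (auto simp: cinner_def)
qed (metis proj_mat_in)

lemma proj_mat_orth: "w \<in> W \<Longrightarrow> cinner (v - proj_mat W *v v) w = 0"
  using orth_proj_cinner[OF W] by (simp add: proj_mat_apply)

lemma proj_mat_idem: "proj_mat W ** proj_mat W = proj_mat W"
  by (simp add: matrix_eq proj_mat_eq_iff proj_mat_in flip: matrix_vector_mul_assoc)

lemma proj_mat_hermitian: "adj (proj_mat W) = proj_mat W"
proof -
  let ?P = "proj_mat W"
  have *: "cinner x (?P *v y) = cinner (?P *v x) (?P *v y)" for x y
    using proj_mat_orth[OF proj_mat_in, of x y] by (simp add: cinner_diff_left)
  have "cinner (adj ?P *v x) y = cinner (?P *v x) y" for x y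
  proof -
    have "cinner (adj ?P *v x) y = cnj (cinner (?P *v y) x)"
      using cinner_commute[of y "adj ?P *v x"] by (simp add: cinner_adj)
    also have "\<dots> = cinner x (?P *v y)" by (rule cinner_commute[symmetric])
    also have "\<dots> = cnj (cinner (?P *v y) (?P *v x))" unfolding *[of x y] by (rule cinner_commute)
    also have "\<dots> = cnj (cinner y (?P *v x))" unfolding *[of y x] ..
    also have "\<dots> = cinner (?P *v x) y" by (rule cinner_commute[symmetric])
    finally show ?thesis .
  qed
  then show ?thesis by (auto simp: matrix_eq intro: cinner_eqI)
qed

end

section \<open>Functionals and the annihilator\<close>

lemma dual_vec_surj: "\<exists>\<xi>. \<phi> = dual_vec \<xi>"
proof
  have lin: "dual_apply \<phi> (x + y) = dual_apply \<phi> x + dual_apply \<phi> y"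
     "dual_apply \<phi> (c *s x) = c * dual_apply \<phi> x" for x y c
    using dual_apply[of \<phi>] by (auto simp: functional_iff)
  have zero: "dual_apply \<phi> 0 = 0" using lin(2)[of 0 0] by simp
  have sum: "dual_apply \<phi> (\<Sum>i\<in>I. f i) = (\<Sum>i\<in>I. dual_apply \<phi> (f i))" if "finite I" for I and f :: "'a \<Rightarrow> _"
    using that by induction (auto simp: lin zero)
  have expand: "dual_apply \<phi> x = (\<Sum>i\<in>UNIV. x $ i * dual_apply \<phi> (axis i 1))" for x
    by (subst basis_expansion[of x, symmetric], subst sum) (simp_all add: lin)
  show "\<phi> = dual_vec (\<chi> i. cnj (dual_apply \<phi> (axis i 1)))"
    by (rule dual_apply_inject[THEN iffD1], rule ext, subst expand) (simp add: dual_vec.rep_eq cinner_def)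
qed

lemma dual_vec_diff: "dual_vec x - dual_vec y = dual_vec (x - y)"
  by transfer (simp add: cinner_diff_right)

lemma dual_inner_self_eq_0: "dual_inner \<phi> \<phi> = 0 \<Longrightarrow> \<phi> = 0"
  by (metis cancel_comm_monoid_add_class.diff_cancel cinner_self_eq_0 dual_inner_dual_vec dual_vec_diff dual_vec_surj)

text \<open>Through \<open>dual_vec\<close> the annihilator is the orthogonal complement of
  \<open>V\<close>, and \<open>dual_vec\<close> preserves orthogonality, so the complementary
  projection is transported.\<close>

lemma orth_proj_annihilator:
  assumes V: "vec.subspace V"
  shows "orth_proj dual_inner (annihilator V) (dual_vec \<xi>) = dual_vec (\<xi> - proj_mat V *v \<xi>)"
proof (rule orth_proj_eqI)
  show "dual_inner (x - y) z = dual_inner x z - dual_inner y z" for x y z :: "'a dual"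
    by (simp add: dual_inner_def minus_dual.rep_eq left_diff_distrib sum_subtractf)
  show "dual_vec (\<xi> - proj_mat V *v \<xi>) \<in> annihilator V"
    using proj_mat_orth[OF V] by (auto simp: annihilator_def dual_vec.rep_eq) (metis cinner_commute complex_cnj_zero)
  show "dual_inner (dual_vec \<xi> - dual_vec (\<xi> - proj_mat V *v \<xi>)) w = 0" if "w \<in> annihilator V" for w
  proof -
    obtain \<eta> where "w = dual_vec \<eta>" using dual_vec_surj by blast
    then show ?thesis using that proj_mat_in[OF V, of \<xi>]
      by (auto simp: annihilator_def dual_vec.rep_eq dual_vec_diff dual_inner_dual_vec)
         (metis cinner_commute complex_cnj_zero)
  qed
qed (auto simp: annihilator_def minus_dual.rep_eq dual_inner_self_eq_0)

lemma dual_pairing_annihilator: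
  assumes V: "vec.subspace V"
  shows "dual_pairing \<rho> (orth_proj dual_inner (annihilator V)) = trace (\<rho> ** (mat 1 - proj_mat V))"
proof -
  have "predual_op (orth_proj dual_inner (annihilator V)) $ i $ j = (mat 1 - proj_mat V) $ i $ j" for i j
  proof -
    \<comment> \<open>Since \<open>dual_vec\<close> is conjugate-linear, \<open>predual_op\<close>
      reads off the conjugate of entry (j, i) of the complementary projection; hermiticity turns
      this into entry (i, j).\<close>
    have "cnj ((proj_mat V *v axis i 1) $ j) = adj (proj_mat V) $ i $ j" by (simp add: adj_def matrix_vector_mult_axis)
    then show ?thesis
      by (simp add: predual_op_def orth_proj_annihilator[OF V] dual_vec.rep_eq cinner_axis_left
           proj_mat_hermitian[OF V]) (simp add: axis_def mat_def)
  qed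
  then have "predual_op (orth_proj dual_inner (annihilator V)) = mat 1 - proj_mat V"
    unfolding vec_eq_iff by blast
  then show ?thesis by (simp add: dual_pairing_def)
qed

section \<open>Anti-systems as subspaces of the tensor square\<close>

text \<open>The tensor product of \<open>M\<close> and \<open>conj_mat N\<close>, written by entries
  because \<open>mat_tensor\<close> takes square matrices.\<close>

definition conj_tensor :: "complex^'x^'a \<Rightarrow> complex^'y^'b \<Rightarrow> complex^('x \<times> 'y)^('a \<times> 'b)" where
  "conj_tensor M N = (\<chi> k l. M $ fst k $ fst l * cnj (N $ snd k $ snd l))"

text \<open>By \<open>theta_nth\<close> the functional is paired with the first leg of
  \<open>u\<close> while the second leg is the output, so \<open>dual_op M\<close> acts on the first
  leg as \<open>M\<close> and \<open>conj_mat N\<close> on the second.\<close>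

lemma theta_conj_tensor:
  fixes M N :: "complex^'x::finite^'a::finite"
  shows "(*v) (conj_mat N) \<circ> theta u \<circ> dual_op M = theta (conj_tensor M N *v u)"
proof (rule ext)
  fix \<phi> :: "'a dual"
  obtain \<xi> where phi: "\<phi> = dual_vec \<xi>" using dual_vec_surj by blast
  have d: "dual_apply (dual_op M \<phi>) (axis i 1) = (\<Sum>a\<in>UNIV. M $ a $ i * dual_apply \<phi> (axis a 1))" for i
    by (simp add: phi dual_op.rep_eq dual_vec.rep_eq cinner_axis_left)
      (simp add: cinner_def matrix_vector_mult_axis)
  have "((*v) (conj_mat N) \<circ> theta u \<circ> dual_op M) \<phi> $ b = theta (conj_tensor M N *v u) \<phi> $ b" for b
  proof -
    have "((*v) (conj_mat N) \<circ> theta u \<circ> dual_op M) \<phi> $ b =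
      (\<Sum>y\<in>UNIV. \<Sum>x\<in>UNIV. \<Sum>a\<in>UNIV. cnj (N $ b $ y) * (u $ (x, y) * (M $ a $ x * dual_apply \<phi> (axis a 1))))"
      by (simp add: matrix_vector_mult_def theta_nth d conj_mat_def adj_def transpose_def sum_distrib_left)
    also have "\<dots> = (\<Sum>x\<in>UNIV. \<Sum>y\<in>UNIV. \<Sum>a\<in>UNIV. cnj (N $ b $ y) * (u $ (x, y) * (M $ a $ x * dual_apply \<phi> (axis a 1))))"
      by (rule sum.swap)
    also have "\<dots> = (\<Sum>x\<in>UNIV. \<Sum>a\<in>UNIV. \<Sum>y\<in>UNIV. cnj (N $ b $ y) * (u $ (x, y) * (M $ a $ x * dual_apply \<phi> (axis a 1))))"
      by (intro sum.cong refl sum.swap)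
    also have "\<dots> = (\<Sum>a\<in>UNIV. \<Sum>x\<in>UNIV. \<Sum>y\<in>UNIV. cnj (N $ b $ y) * (u $ (x, y) * (M $ a $ x * dual_apply \<phi> (axis a 1))))"
      by (rule sum.swap)
    also have "\<dots> = theta (conj_tensor M N *v u) \<phi> $ b"
      by (simp add: theta_nth matrix_vector_mult_def conj_tensor_def sum_UNIV_prod sum_distrib_right sum_distrib_left mult_ac)
    finally show ?thesis .
  qed
  then show "((*v) (conj_mat N) \<circ> theta u \<circ> dual_op M) \<phi> = theta (conj_tensor M N *v u) \<phi>"
    by (simp add: vec_eq_iff)
qed

lemma theta_inject: "theta u = theta v \<longleftrightarrow> u = v"
proof
  assume "theta u = theta v"
  have "theta w (dual_vec (axis i 1)) $ j = w $ (i, j)" for w :: "complex^('a \<times> 'a)" and i j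
  proof -
    have "theta w (dual_vec (axis i 1)) $ j = (\<Sum>k\<in>UNIV. if k = i then w $ (k, j) else 0)"
      unfolding theta_nth by (intro sum.cong refl, simp add: dual_vec.rep_eq cinner_axis_left, simp add: axis_def)
    then show ?thesis by simp
  qed
  with \<open>theta u = theta v\<close> show "u = v" by (metis vec_eq_iff surj_pair)
qed simp

lemma antisystem_of_maps_iff:
  "(\<forall>S\<in>antisystem_of U. (*v) (conj_mat N) \<circ> S \<circ> dual_op M \<in> antisystem_of V) \<longleftrightarrow>
    (\<forall>u\<in>U. conj_tensor M N *v u \<in> V)"
  by (simp add: antisystem_of_def theta_conj_tensor image_iff theta_inject)

text \<open>A matrix equation is what a vanishing sum of squares delivers, and it can be substituted
  into a trace; both directions of the theorem use the inclusion in this form.\<close>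

lemma maps_into_iff:
  assumes U: "vec.subspace U" and V: "vec.subspace V"
  shows "(\<forall>u\<in>U. T *v u \<in> V) \<longleftrightarrow> (mat 1 - proj_mat V) ** T ** proj_mat U = 0"
proof -
  have "v - proj_mat V *v v = 0 \<longleftrightarrow> v \<in> V" for v
    using proj_mat_eq_iff[OF V, of v] by auto
  then have "(mat 1 - proj_mat V) ** T ** proj_mat U = 0 \<longleftrightarrow> (\<forall>x. T *v (proj_mat U *v x) \<in> V)"
    by (simp add: matrix_eq matrix_vector_mult_diff_rdistrib flip: matrix_vector_mul_assoc)
  also have "\<dots> \<longleftrightarrow> (\<forall>u\<in>U. T *v u \<in> V)"
    by (metis proj_mat_eq_iff[OF U] proj_mat_in[OF U])
  finally show ?thesis by blast
qed

subsection \<open>Kraus maps\<close>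

lemma nonneg_Reals_add_eq_0D:
  fixes a b :: complex
  assumes "a \<in> \<real>\<^sub>\<ge>\<^sub>0" "b \<in> \<real>\<^sub>\<ge>\<^sub>0" "a + b = 0"
  shows "a = 0"
  using assms by (auto simp: complex_nonneg_Reals_iff complex_eq_iff)

lemma sum_nonneg_Reals: "(\<And>i. i \<in> I \<Longrightarrow> f i \<in> \<real>\<^sub>\<ge>\<^sub>0) \<Longrightarrow> (\<Sum>i\<in>I. f i :: complex) \<in> \<real>\<^sub>\<ge>\<^sub>0"
  by (induction I rule: infinite_finite_induct) (auto intro: nonneg_Reals_add_I)

lemma sum_nonneg_Reals_eq_0:
  fixes f :: "'i \<Rightarrow> complex"
  assumes "finite I" and f: "\<And>i. i \<in> I \<Longrightarrow> f i \<in> \<real>\<^sub>\<ge>\<^sub>0" and "(\<Sum>i\<in>I. f i) = 0" and i: "i \<in> I"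
  shows "f i = 0"
proof -
  have "(\<Sum>i\<in>I. Re (f i)) = 0" using assms(3) by (simp flip: Re_sum)
  moreover have "0 \<le> Re (f j)" if "j \<in> I" for j using f[OF that] by (simp add: complex_nonneg_Reals_iff)
  ultimately have "Re (f i) = 0" using assms(1) i by (subst (asm) sum_nonneg_eq_0_iff) blast+
  then show ?thesis using f[OF i] by (simp add: complex_nonneg_Reals_iff complex_eq_iff)
qed

text \<open>The entries of \<open>\<Sum>i\<in>I. adj (N i) ** N i = mat 1\<close>. The index set is
  arbitrary so that families indexed by pairs are covered.\<close>

definition kraus_normalized :: "'i set \<Rightarrow> ('i \<Rightarrow> complex^'n^'m) \<Rightarrow> bool" where
  "kraus_normalized I N \<longleftrightarrow>
     (\<forall>x x'. (\<Sum>i\<in>I. \<Sum>a\<in>UNIV. N i $ a $ x * cnj (N i $ a $ x')) = (if x = x' then 1 else 0))"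

definition kraus_map :: "'i set \<Rightarrow> ('i \<Rightarrow> complex^'n^'m) \<Rightarrow> complex^'n^'n \<Rightarrow> complex^'m^'m" where
  "kraus_map I N R = (\<Sum>i\<in>I. N i ** R ** adj (N i))"

lemma kraus_term_nth: "(N ** R ** adj N) $ a $ a' = (\<Sum>x\<in>UNIV. \<Sum>x'\<in>UNIV. N $ a $ x * R $ x $ x' * cnj (N $ a' $ x'))"
  by (simp add: matrix_matrix_mult_def adj_def sum_distrib_right) (rule sum.swap)

lemma kraus_map_nth: "kraus_map I N R $ a $ a' =
    (\<Sum>i\<in>I. \<Sum>x\<in>UNIV. \<Sum>x'\<in>UNIV. N i $ a $ x * R $ x $ x' * cnj (N i $ a' $ x'))"
  by (simp add: kraus_map_def kraus_term_nth)

text \<open>Moving \<open>N i\<close> across the inner product leaves the form of \<open>R\<close>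
  at the vectors \<open>adj (N i) *v v\<close>; this reduces block positivity of the image to that
  of the argument.\<close>

lemma kraus_map_apply: "cinner (kraus_map I N R *v v) w = (\<Sum>i\<in>I. cinner (R *v (adj (N i) *v v)) (adj (N i) *v w))"
proof -
  have "kraus_map I N R *v v = (\<Sum>i\<in>I. (N i ** R ** adj (N i)) *v v)"
    by (simp add: kraus_map_def vec_eq_iff matrix_vector_mult_def sum_distrib_right) (auto intro: sum.swap)
  also have "\<dots> = (\<Sum>i\<in>I. N i *v (R *v (adj (N i) *v v)))"
    by (simp add: matrix_vector_mul_assoc matrix_mul_assoc)
  finally have "kraus_map I N R *v v = (\<Sum>i\<in>I. N i *v (R *v (adj (N i) *v v)))" .
  moreover have "cinner (\<Sum>i\<in>I. f i) w = (\<Sum>i\<in>I. cinner (f i) w)" for f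
    by (simp add: cinner_def sum_distrib_right) (rule sum.swap)
  ultimately show ?thesis by (simp add: cinner_adj)
qed

lemma vector_space_mat_scale: "vector_space (mat_scale :: complex \<Rightarrow> complex^'n^'m \<Rightarrow> _)"
  by unfold_locales (simp_all add: mat_scale_def vec_eq_iff algebra_simps)

lemma mat_linear_iff: "mat_linear F \<longleftrightarrow> (\<forall>R S. F (R + S) = F R + F S) \<and> (\<forall>c R. F (c *\<^sub>m R) = c *\<^sub>m F R)"
  by (simp add: mat_linear_def Vector_Spaces.linear_iff vector_space_mat_scale)

lemma trace_kraus_map:
  "trace (kraus_map I N R) = (\<Sum>x\<in>UNIV. \<Sum>x'\<in>UNIV. R $ x $ x' * (\<Sum>i\<in>I. \<Sum>a\<in>UNIV. N i $ a $ x * cnj (N i $ a $ x')))"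
proof -
  let ?f = "\<lambda>i a x x'. R $ x $ x' * (N i $ a $ x * cnj (N i $ a $ x'))"
  have "trace (kraus_map I N R) = (\<Sum>a\<in>UNIV. \<Sum>i\<in>I. \<Sum>x\<in>UNIV. \<Sum>x'\<in>UNIV. ?f i a x x')"
    by (simp add: trace_def kraus_map_nth mult_ac)
  also have "\<dots> = (\<Sum>i\<in>I. \<Sum>a\<in>UNIV. \<Sum>x\<in>UNIV. \<Sum>x'\<in>UNIV. ?f i a x x')" by (rule sum.swap)
  also have "\<dots> = (\<Sum>i\<in>I. \<Sum>x\<in>UNIV. \<Sum>a\<in>UNIV. \<Sum>x'\<in>UNIV. ?f i a x x')" by (intro sum.cong refl sum.swap)
  also have "\<dots> = (\<Sum>i\<in>I. \<Sum>x\<in>UNIV. \<Sum>x'\<in>UNIV. \<Sum>a\<in>UNIV. ?f i a x x')" by (intro sum.cong refl sum.swap)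
  also have "\<dots> = (\<Sum>x\<in>UNIV. \<Sum>i\<in>I. \<Sum>x'\<in>UNIV. \<Sum>a\<in>UNIV. ?f i a x x')" by (rule sum.swap)
  also have "\<dots> = (\<Sum>x\<in>UNIV. \<Sum>x'\<in>UNIV. \<Sum>i\<in>I. \<Sum>a\<in>UNIV. ?f i a x x')" by (intro sum.cong refl sum.swap)
  finally show ?thesis by (simp add: sum_distrib_left)
qed

lemma quantum_channel_kraus_map:
  fixes N :: "'i \<Rightarrow> complex^'n^'m"
  assumes "kraus_normalized I N"
  shows "quantum_channel (kraus_map I N)"
  unfolding quantum_channel_def completely_positive_def
proof (intro conjI allI impI)
  show "mat_linear (kraus_map I N)"
    by (auto simp: mat_linear_iff vec_eq_iff kraus_map_nth mat_scale_def algebra_simps sum.distrib sum_distrib_left)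
  show "trace (kraus_map I N R) = trace R" for R
    by (simp only: trace_kraus_map assms[unfolded kraus_normalized_def, rule_format])
      (simp add: trace_def if_distrib cong: if_cong)
  fix n and R :: "nat \<Rightarrow> nat \<Rightarrow> complex^'n^'n"
  assume R: "block_positive n R"
  show "block_positive n (\<lambda>i j. kraus_map I N (R i j))"
    unfolding block_positive_def
  proof
    fix v :: "nat \<Rightarrow> complex^'m"
    let ?f = "\<lambda>k i j. cinner (R i j *v (adj (N k) *v v j)) (adj (N k) *v v i)"
    have "(\<Sum>i<n. \<Sum>j<n. cinner (kraus_map I N (R i j) *v v j) (v i)) = (\<Sum>i<n. \<Sum>j<n. \<Sum>k\<in>I. ?f k i j)"
      by (simp add: kraus_map_apply)
    also have "\<dots> = (\<Sum>i<n. \<Sum>k\<in>I. \<Sum>j<n. ?f k i j)" by (intro sum.cong refl sum.swap)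
    also have "\<dots> = (\<Sum>k\<in>I. \<Sum>i<n. \<Sum>j<n. ?f k i j)" by (rule sum.swap)
    also have "\<dots> \<in> \<real>\<^sub>\<ge>\<^sub>0"
    proof (rule sum_nonneg_Reals)
      fix k show "(\<Sum>i<n. \<Sum>j<n. ?f k i j) \<in> \<real>\<^sub>\<ge>\<^sub>0"
        using R[unfolded block_positive_def, rule_format, of "\<lambda>i. adj (N k) *v v i"] .
    qed
    finally show "(\<Sum>i<n. \<Sum>j<n. cinner (kraus_map I N (R i j) *v v j) (v i)) \<in> \<real>\<^sub>\<ge>\<^sub>0" .
  qed
qed

lemma mat_unit_nth: "mat_unit i j $ k $ l = (if k = i \<and> l = j then 1 else 0)"
  by (simp add: rank_one_def axis_def)

lemma kraus_map_mat_unit: "kraus_map I N (mat_unit x x') $ a $ a' = (\<Sum>i\<in>I. N i $ a $ x * cnj (N i $ a' $ x'))"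
proof -
  have "(\<Sum>y\<in>UNIV. \<Sum>y'\<in>UNIV. N i $ a $ y * mat_unit x x' $ y $ y' * cnj (N i $ a' $ y')) =
    N i $ a $ x * cnj (N i $ a' $ x')" for i
  proof -
    have "(\<Sum>y\<in>UNIV. \<Sum>y'\<in>UNIV. N i $ a $ y * mat_unit x x' $ y $ y' * cnj (N i $ a' $ y')) =
      (\<Sum>y\<in>UNIV. \<Sum>y'\<in>UNIV. if y' = x' then if y = x then N i $ a $ y * cnj (N i $ a' $ y') else 0 else 0)"
      by (intro sum.cong) (auto simp: mat_unit_nth)
    then show ?thesis by simp
  qed
  then show ?thesis by (simp add: kraus_map_nth)
qed

text \<open>Testing trace preservation on matrix units recovers the normalization, so a channel
  known only through its Kraus formula yields a normalized family.\<close>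

lemma kraus_normalized_iff_trace:
  "kraus_normalized I N \<longleftrightarrow> (\<forall>R. trace (kraus_map I N R) = trace R)"
proof
  show "\<forall>R. trace (kraus_map I N R) = trace R" if "kraus_normalized I N"
    using quantum_channel_kraus_map[OF that] by (simp add: quantum_channel_def)
  assume tr: "\<forall>R. trace (kraus_map I N R) = trace R"
  show "kraus_normalized I N"
    unfolding kraus_normalized_def
  proof (intro allI)
    fix x x'
    have "(\<Sum>i\<in>I. \<Sum>a\<in>UNIV. N i $ a $ x * cnj (N i $ a $ x')) = trace (kraus_map I N (mat_unit x x'))"
      unfolding trace_def kraus_map_mat_unit by (rule sum.swap)
    also have "\<dots> = trace (mat_unit x x')" by (rule tr[rule_format])
    also have "\<dots> = (\<Sum>k\<in>UNIV. if k = x then if x = x' then 1 else 0 else 0)"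
      unfolding trace_def mat_unit_nth by (intro sum.cong) auto
    finally show "(\<Sum>i\<in>I. \<Sum>a\<in>UNIV. N i $ a $ x * cnj (N i $ a $ x')) = (if x = x' then 1 else 0)"
      by simp
  qed
qed

lemma kraus_normalized_conj: "kraus_normalized I N \<Longrightarrow> kraus_normalized I (\<lambda>i. conj_mat (N i))"
  unfolding kraus_normalized_def
proof (intro allI)
  fix x x' assume *: "\<forall>x x'. (\<Sum>i\<in>I. \<Sum>a\<in>UNIV. N i $ a $ x * cnj (N i $ a $ x')) = (if x = x' then 1 else 0)"
  have "(\<Sum>i\<in>I. \<Sum>a\<in>UNIV. conj_mat (N i) $ a $ x * cnj (conj_mat (N i) $ a $ x')) =
    (\<Sum>i\<in>I. \<Sum>a\<in>UNIV. N i $ a $ x' * cnj (N i $ a $ x))"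
    by (simp add: conj_mat_def adj_def transpose_def mult.commute)
  with * show "(\<Sum>i\<in>I. \<Sum>a\<in>UNIV. conj_mat (N i) $ a $ x * cnj (conj_mat (N i) $ a $ x')) = (if x = x' then 1 else 0)"
    by auto
qed

section \<open>Product maps as correlations\<close>

lemma kraus_map_tensor:
  fixes M :: "'i \<Rightarrow> complex^'x::finite^'a::finite" and N :: "'j \<Rightarrow> complex^'y::finite^'b::finite"
  shows "kraus_map (I \<times> J) (\<lambda>(i, j). conj_tensor (M i) (N j)) (S \<otimes>\<^sub>m T) =
    kraus_map I M S \<otimes>\<^sub>m kraus_map J (\<lambda>j. conj_mat (N j)) T"
proof -
  have "kraus_map (I \<times> J) (\<lambda>(i, j). conj_tensor (M i) (N j)) (S \<otimes>\<^sub>m T) $ k $ l =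
    (kraus_map I M S \<otimes>\<^sub>m kraus_map J (\<lambda>j. conj_mat (N j)) T) $ k $ l" for k l
  proof -
    let ?f = "\<lambda>i x x'. M i $ fst k $ x * S $ x $ x' * cnj (M i $ fst l $ x')"
    let ?g = "\<lambda>j y y'. cnj (N j $ snd k $ y) * T $ y $ y' * N j $ snd l $ y'"
    have "kraus_map (I \<times> J) (\<lambda>(i, j). conj_tensor (M i) (N j)) (S \<otimes>\<^sub>m T) $ k $ l =
      (\<Sum>i\<in>I. \<Sum>j\<in>J. \<Sum>x\<in>UNIV. \<Sum>y\<in>UNIV. \<Sum>x'\<in>UNIV. \<Sum>y'\<in>UNIV. ?f i x x' * ?g j y y')"
      by (simp add: kraus_map_nth sum_UNIV_prod conj_tensor_def mat_tensor_def mult_ac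
          sum.cartesian_product'[of _ I J])
    also have "\<dots> = (\<Sum>i\<in>I. \<Sum>j\<in>J. \<Sum>x\<in>UNIV. \<Sum>x'\<in>UNIV. \<Sum>y\<in>UNIV. \<Sum>y'\<in>UNIV. ?f i x x' * ?g j y y')"
      by (intro sum.cong refl sum.swap)
    also have "\<dots> = (\<Sum>i\<in>I. \<Sum>x\<in>UNIV. \<Sum>x'\<in>UNIV. ?f i x x') * (\<Sum>j\<in>J. \<Sum>y\<in>UNIV. \<Sum>y'\<in>UNIV. ?g j y y')"
      by (simp only: sum_product[of _ I], simp only: sum_distrib_right, simp only: sum_distrib_left)
    also have "\<dots> = (kraus_map I M S \<otimes>\<^sub>m kraus_map J (\<lambda>j. conj_mat (N j)) T) $ k $ l"
      by (simp add: mat_tensor_def kraus_map_nth conj_mat_def adj_def transpose_def)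
    finally show ?thesis .
  qed
  then show ?thesis by (simp add: vec_eq_iff)
qed

lemma kraus_normalized_tensor:
  fixes M :: "'i \<Rightarrow> complex^'x::finite^'a::finite" and N :: "'j \<Rightarrow> complex^'y::finite^'b::finite"
  assumes M: "kraus_normalized I M" and N: "kraus_normalized J N"
  shows "kraus_normalized (I \<times> J) (\<lambda>(i, j). conj_tensor (M i) (N j))"
  unfolding kraus_normalized_def
proof (intro allI)
  fix k l :: "'x \<times> 'y"
  let ?f = "\<lambda>i a. M i $ a $ fst k * cnj (M i $ a $ fst l)"
  let ?g = "\<lambda>j b. N j $ b $ snd l * cnj (N j $ b $ snd k)"
  have "(\<Sum>i\<in>I \<times> J. \<Sum>a\<in>UNIV. (case i of (i, j) \<Rightarrow> conj_tensor (M i) (N j)) $ a $ k *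
      cnj ((case i of (i, j) \<Rightarrow> conj_tensor (M i) (N j)) $ a $ l)) =
      (\<Sum>i\<in>I. \<Sum>j\<in>J. \<Sum>a\<in>UNIV. \<Sum>b\<in>UNIV. ?f i a * ?g j b)"
    by (simp add: sum_UNIV_prod sum.cartesian_product'[of _ I J] conj_tensor_def mult_ac)
  also have "\<dots> = (\<Sum>i\<in>I. \<Sum>a\<in>UNIV. ?f i a) * (\<Sum>j\<in>J. \<Sum>b\<in>UNIV. ?g j b)"
    by (simp only: sum_product[of _ I], simp only: sum_distrib_right, simp only: sum_distrib_left)
  also have "\<dots> = (if k = l then 1 else 0)"
    using M N by (auto simp: kraus_normalized_def prod_eq_iff)
  finally show "(\<Sum>i\<in>I \<times> J. \<Sum>a\<in>UNIV. (case i of (i, j) \<Rightarrow> conj_tensor (M i) (N j)) $ a $ k *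
      cnj ((case i of (i, j) \<Rightarrow> conj_tensor (M i) (N j)) $ a $ l)) = (if k = l then 1 else 0)" .
qed

lemma ptrace_mat_tensor:
  "ptrace_fst (S \<otimes>\<^sub>m T) = trace S *\<^sub>m T" "ptrace_snd (S \<otimes>\<^sub>m T) = trace T *\<^sub>m S"
  by (simp_all add: ptrace_fst_def ptrace_snd_def mat_tensor_def mat_scale_def trace_def vec_eq_iff
      sum_distrib_left sum_distrib_right mult_ac)

text \<open>On product inputs the map is a tensor product of two channels, so tracing out one leg
  leaves the trace of that input as a scalar factor.\<close>

lemma QNS_correlation_kraus_map:
  fixes M :: "'i \<Rightarrow> complex^'x::finite^'a::finite" and N :: "'j \<Rightarrow> complex^'x^'a"
  assumes M: "kraus_normalized I M" and N: "kraus_normalized J N"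
  shows "QNS_correlation (kraus_map (I \<times> J) (\<lambda>(i, j). conj_tensor (M i) (N j)))"
proof -
  have "trace (kraus_map I M S) = trace S" "trace (kraus_map J (\<lambda>j. conj_mat (N j)) S) = trace S" for S
    using M kraus_normalized_conj[OF N] by (auto simp: kraus_normalized_iff_trace)
  then show ?thesis
    using quantum_channel_kraus_map[OF kraus_normalized_tensor[OF M N]]
    by (simp add: QNS_correlation_def kraus_map_tensor ptrace_mat_tensor)
      (simp add: mat_scale_def vec_eq_iff)
qed

lemma sum_mat_unit_tensor:
  "(\<Sum>a\<in>UNIV. \<Sum>a'\<in>UNIV. \<Sum>b\<in>UNIV. \<Sum>b'\<in>UNIV. c a a' b b' *\<^sub>m (mat_unit a a' \<otimes>\<^sub>m mat_unit b b')) =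
    (\<chi> k l. c (fst k) (fst l) (snd k) (snd l))"
proof -
  have "(\<Sum>a\<in>UNIV. \<Sum>a'\<in>UNIV. \<Sum>b\<in>UNIV. \<Sum>b'\<in>UNIV. c a a' b b' *\<^sub>m (mat_unit a a' \<otimes>\<^sub>m mat_unit b b')) $ k $ l =
    c (fst k) (fst l) (snd k) (snd l)" for k l
  proof -
    have "(\<Sum>a\<in>UNIV. \<Sum>a'\<in>UNIV. \<Sum>b\<in>UNIV. \<Sum>b'\<in>UNIV. c a a' b b' *\<^sub>m (mat_unit a a' \<otimes>\<^sub>m mat_unit b b')) $ k $ l =
     (\<Sum>a\<in>UNIV. \<Sum>a'\<in>UNIV. \<Sum>b\<in>UNIV. \<Sum>b'\<in>UNIV. if b' = snd l then if b = snd k then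
        if a' = fst l then if a = fst k then c a a' b b' else 0 else 0 else 0 else 0)"
      unfolding sum_component by (intro sum.cong refl) (auto simp: mat_scale_def mat_tensor_def mat_unit_nth)
    then show ?thesis by simp
  qed
  then show ?thesis by (simp add: vec_eq_iff)
qed

text \<open>\<open>locally_tracial\<close> prescribes a map on tensor products of matrix units;
  linearity carries this to the projection onto \<open>U\<close>.\<close>

lemma mat_linear_expansion:
  assumes F: "mat_linear F"
  shows "F R = (\<Sum>x\<in>UNIV. \<Sum>x'\<in>UNIV. \<Sum>y\<in>UNIV. \<Sum>y'\<in>UNIV.
    R $ (x, y) $ (x', y') *\<^sub>m F (mat_unit x x' \<otimes>\<^sub>m mat_unit y y'))"
proof -
  interpret F: Vector_Spaces.linear mat_scale mat_scale F using F by (simp add: mat_linear_def)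
  have "R = (\<Sum>x\<in>UNIV. \<Sum>x'\<in>UNIV. \<Sum>y\<in>UNIV. \<Sum>y'\<in>UNIV.
    R $ (x, y) $ (x', y') *\<^sub>m (mat_unit x x' \<otimes>\<^sub>m mat_unit y y'))"
    by (subst sum_mat_unit_tensor) (simp add: vec_eq_iff)
  then have "F R = F \<dots>" by simp
  then show ?thesis by (simp add: F.sum F.scale)
qed

text \<open>Induction by removing one index, subtracting from the other vectors their components in the direction
  of the removed one.\<close>
lemma gram_matrix_factorization:
  fixes v :: "nat \<Rightarrow> 's \<Rightarrow> complex"
  assumes "finite S"
  shows "\<exists>h. \<forall>s\<in>S. \<forall>t\<in>S. (\<Sum>i<m. v i s * cnj (v i t)) = (\<Sum>p\<in>S. cnj (h p s) * h p t)"
  using assms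
proof (induction S arbitrary: v rule: finite_induct)
  case (insert r S)
  define n where "n = (\<Sum>i<m. (cmod (v i r))\<^sup>2)"
  \<comment> \<open>If \<open>n = 0\<close>, division by zero makes every \<open>u i\<close> zero;
    so is \<open>v i r\<close> for \<open>i < m\<close>, and \<open>ar\<close> holds in this case
    too.\<close>
  define u where "u i = v i r / complex_of_real (sqrt n)" for i
  define \<alpha> where "\<alpha> t = (\<Sum>i<m. v i t * cnj (u i))" for t
  define w where "w i t = v i t - \<alpha> t * u i" for i t
  have n0: "0 \<le> n" by (simp add: n_def sum_nonneg)
  have nn: "(\<Sum>i<m. v i r * cnj (v i r)) = complex_of_real n"
    unfolding n_def of_real_sum complex_norm_square ..
  have ss: "complex_of_real (sqrt n) * complex_of_real (sqrt n) = complex_of_real n"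
    using n0 by (simp flip: of_real_mult)
  have ar: "\<alpha> r * u i = v i r" if "i < m" for i
  proof (cases "n = 0")
    case True
    then have "v i r = 0" using that by (simp add: n_def sum_nonneg_eq_0_iff)
    then show ?thesis by (simp add: u_def)
  next
    case False
    have "\<alpha> r = complex_of_real n / complex_of_real (sqrt n)"
      by (simp add: \<alpha>_def u_def nn flip: sum_divide_distrib)
    with False ss show ?thesis by (simp add: u_def)
  qed
  have wr: "w i r = 0" if "i < m" for i using ar[OF that] by (simp add: w_def)
  have un: "\<alpha> s * cnj (\<alpha> t) * (\<Sum>i<m. u i * cnj (u i)) = \<alpha> s * cnj (\<alpha> t)" for s t
  proof (cases "n = 0")
    case True
    then show ?thesis by (simp add: \<alpha>_def u_def)
  next
    case False
    have "(\<Sum>i<m. u i * cnj (u i)) = 1"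
      using False ss by (simp add: u_def nn flip: sum_divide_distrib)
    then show ?thesis by simp
  qed
  have gram: "(\<Sum>i<m. v i s * cnj (v i t)) = \<alpha> s * cnj (\<alpha> t) + (\<Sum>i<m. w i s * cnj (w i t))" for s t
  proof -
    have "(\<Sum>i<m. w i s * cnj (w i t)) = (\<Sum>i<m. v i s * cnj (v i t)) - (\<Sum>i<m. v i s * cnj (u i)) * cnj (\<alpha> t)
       - \<alpha> s * cnj (\<Sum>i<m. v i t * cnj (u i)) + \<alpha> s * cnj (\<alpha> t) * (\<Sum>i<m. u i * cnj (u i))"
      by (simp add: w_def algebra_simps sum.distrib sum_subtractf sum_distrib_left)
    then show ?thesis unfolding un by (simp flip: \<alpha>_def)
  qed
  obtain h where h: "\<forall>s\<in>S. \<forall>t\<in>S. (\<Sum>i<m. w i s * cnj (w i t)) = (\<Sum>p\<in>S. cnj (h p s) * h p t)"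
    using insert.IH by blast
  \<comment> \<open>Row \<open>r\<close> carries the rank one part, conjugated because the Gram sum
    conjugates its second factor and the factorization its first. Column \<open>r\<close> of the old
    rows is cleared since the induction hypothesis says nothing about it.\<close>
  define h' where "h' p t = (if p = r then cnj (\<alpha> t) else if t = r then 0 else h p t)" for p t
  have "(\<Sum>i<m. v i s * cnj (v i t)) = (\<Sum>p\<in>insert r S. cnj (h' p s) * h' p t)"
    if "s \<in> insert r S" "t \<in> insert r S" for s t
  proof -
    have "(\<Sum>p\<in>insert r S. cnj (h' p s) * h' p t) = \<alpha> s * cnj (\<alpha> t) + (\<Sum>p\<in>S. cnj (h' p s) * h' p t)"
      using insert.hyps by (simp add: h'_def)
    moreover have "(\<Sum>p\<in>S. cnj (h' p s) * h' p t) = (\<Sum>i<m. w i s * cnj (w i t))"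
    proof (cases "s = r \<or> t = r")
      case True
      then have "(\<Sum>p\<in>S. cnj (h' p s) * h' p t) = 0"
        using insert.hyps by (intro sum.neutral) (auto simp: h'_def)
      moreover have "(\<Sum>i<m. w i s * cnj (w i t)) = 0"
        using True wr by (intro sum.neutral) auto
      ultimately show ?thesis by simp
    next
      case False
      then have "(\<Sum>p\<in>S. cnj (h' p s) * h' p t) = (\<Sum>p\<in>S. cnj (h p s) * h p t)"
        using insert.hyps by (intro sum.cong) (auto simp: h'_def)
      with False h that show ?thesis by auto
    qed
    ultimately show ?thesis using gram by simp
  qed
  then show ?case by blast
qed simp

subsection \<open>Characters of abelian C*-algebras\<close>

context abelian_cstar_algebra
begin

sublocale cring C
  by unfold_locales (use abelian in auto)

section \<open>Scalars, involution and norm\<close>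

text \<open>With scalars as ring elements, scalar multiples are products and come within reach of
  the method \<open>algebra\<close>.\<close>

definition emb :: "complex \<Rightarrow> 'c" where
  "emb c = c \<odot> \<one>"

lemma emb_closed [simp, intro]: "emb c \<in> carrier C"
  using smult_closed[of c \<one>] by (simp add: emb_def complex_field_def)

lemma smult_carrier [simp, intro]: "x \<in> carrier C \<Longrightarrow> c \<odot> x \<in> carrier C"
  using smult_closed[of c x] by (simp add: complex_field_def)

lemma emb_mult_eq_smult: "x \<in> carrier C \<Longrightarrow> emb c \<otimes> x = c \<odot> x"
  using smult_mult_left[of \<one> x c] by (simp add: emb_def)

lemma emb_add: "emb (c + d) = emb c \<oplus> emb d"
  using smult_l_distr[of c d \<one>] by (simp add: emb_def complex_field_def)

lemma emb_mult: "emb (c * d) = emb c \<otimes> emb d"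
  using smult_assoc1[of c d \<one>] emb_mult_eq_smult[of "emb d" c]
  by (simp add: complex_field_def) (simp add: emb_def)

lemma emb_one [simp]: "emb 1 = \<one>"
  using smult_one[of \<one>] by (simp add: emb_def complex_field_def)

lemma emb_zero [simp]: "emb 0 = \<zero>"
  using emb_add[of 0 0] by (metis add.r_cancel_one' add_0 emb_closed)

lemma emb_uminus: "emb (- c) = \<ominus> emb c"
  using emb_add[of "- c" c] by (simp add: minus_equality)

lemma emb_diff: "emb (c - d) = emb c \<ominus> emb d"
  using emb_add[of c "- d"] by (simp add: emb_uminus a_minus_def)

lemma right_minus_eq_zero [simp]: "x \<in> carrier C \<Longrightarrow> y \<in> carrier C \<Longrightarrow> x \<ominus> y = \<zero> \<longleftrightarrow> x = y"
  by (metis a_minus_def add.inv_closed add.inv_solve_right' l_zero zero_closed)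

lemma star_one [simp]: "star C \<one> = \<one>"
proof -
  have "star C \<one> = star C \<one> \<otimes> star C (star C \<one>)" by (simp add: star_star star_closed)
  also have "\<dots> = star C (star C \<one> \<otimes> \<one>)" by (subst star_mult) (auto simp: star_closed)
  also have "\<dots> = \<one>" by (simp add: star_closed star_star)
  finally show ?thesis .
qed

lemma star_emb: "star C (emb c) = emb (cnj c)"
  by (simp add: emb_def star_smult)

lemma star_emb_real [simp]: "star C (emb (complex_of_real r)) = emb (complex_of_real r)"
  by (simp add: star_emb)

lemma star_uminus: "x \<in> carrier C \<Longrightarrow> star C (\<ominus> x) = \<ominus> star C x"
proof -
  assume x: "x \<in> carrier C"
  have e: "\<ominus> y = emb (-1) \<otimes> y" if "y \<in> carrier C" for y
    using that emb_uminus[of 1] by (simp add: l_minus)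
  show ?thesis using x
    by (simp add: e star_mult star_closed star_emb m_comm)
qed

lemma star_minus: "x \<in> carrier C \<Longrightarrow> y \<in> carrier C \<Longrightarrow> star C (x \<ominus> y) = star C x \<ominus> star C y"
  by (simp add: a_minus_def star_add star_uminus star_closed)

lemma star_mult': "x \<in> carrier C \<Longrightarrow> y \<in> carrier C \<Longrightarrow> star C (x \<otimes> y) = star C x \<otimes> star C y"
  by (simp add: star_mult m_comm star_closed)

lemma nrm_emb_mult: "x \<in> carrier C \<Longrightarrow> nrm C (emb c \<otimes> x) = cmod c * nrm C x"
  by (simp add: emb_mult_eq_smult nrm_smult)

lemma nrm_uminus: "x \<in> carrier C \<Longrightarrow> nrm C (\<ominus> x) = nrm C x"
  using nrm_emb_mult[of x "-1"] by (simp add: emb_uminus l_minus)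

lemma nrm_minus_commute: "x \<in> carrier C \<Longrightarrow> y \<in> carrier C \<Longrightarrow> nrm C (x \<ominus> y) = nrm C (y \<ominus> x)"
proof -
  assume "x \<in> carrier C" "y \<in> carrier C"
  moreover from this have "x \<ominus> y = \<ominus> (y \<ominus> x)" by algebra
  ultimately show ?thesis using nrm_uminus[of "y \<ominus> x"] by simp
qed

lemma nrm_minus_triangle:
  assumes "x \<in> carrier C" "y \<in> carrier C" "z \<in> carrier C"
  shows "nrm C (x \<ominus> z) \<le> nrm C (x \<ominus> y) + nrm C (y \<ominus> z)"
proof -
  have "x \<ominus> z = (x \<ominus> y) \<oplus> (y \<ominus> z)" using assms by algebra
  then show ?thesis using nrm_triangle[of "x \<ominus> y" "y \<ominus> z"] assms by simp
qed

lemma nrm_zero [simp]: "nrm C \<zero> = 0"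
  by (simp add: nrm_eq_0)

text \<open>The C*-identity and submultiplicativity bound the square of the norm of x by the product
  of the norms of x and its adjoint; exchanging the two gives equality.\<close>

lemma nrm_star: "x \<in> carrier C \<Longrightarrow> nrm C (star C x) = nrm C x"
proof -
  have le: "nrm C x \<le> nrm C (star C x)" if x: "x \<in> carrier C" for x
  proof (cases "nrm C x = 0")
    case False
    have "(nrm C x)\<^sup>2 \<le> nrm C (star C x) * nrm C x"
      using cstar_identity[OF x] nrm_mult[of "star C x" x] x by (simp add: star_closed)
    with False nrm_nonneg[OF x] show ?thesis by (simp add: power2_eq_square)
  qed (use x in \<open>simp add: nrm_nonneg star_closed\<close>)
  assume x: "x \<in> carrier C"
  show ?thesis using le[OF x] le[of "star C x"] x by (simp add: star_star star_closed)
qed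

section \<open>Selfadjoint elements and square roots\<close>

definition selfadjoint :: "'c set" where
  "selfadjoint = {x \<in> carrier C. star C x = x}"

lemma selfadjoint_carrier: "x \<in> selfadjoint \<Longrightarrow> x \<in> carrier C"
  by (simp add: selfadjoint_def)

lemma selfadjoint_star: "x \<in> selfadjoint \<Longrightarrow> star C x = x"
  by (simp add: selfadjoint_def)

lemma selfadjoint_intros [simp, intro]:
  "emb (complex_of_real r) \<in> selfadjoint"
  "\<one> \<in> selfadjoint"
  "x \<in> selfadjoint \<Longrightarrow> y \<in> selfadjoint \<Longrightarrow> x \<oplus> y \<in> selfadjoint"
  "x \<in> selfadjoint \<Longrightarrow> y \<in> selfadjoint \<Longrightarrow> x \<ominus> y \<in> selfadjoint"
  "x \<in> selfadjoint \<Longrightarrow> y \<in> selfadjoint \<Longrightarrow> x \<otimes> y \<in> selfadjoint"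
  "x \<in> selfadjoint \<Longrightarrow> \<ominus> x \<in> selfadjoint"
  by (auto simp: selfadjoint_def star_add star_minus star_mult' star_uminus)

lemma star_mult_self_selfadjoint [simp, intro]: "x \<in> carrier C \<Longrightarrow> star C x \<otimes> x \<in> selfadjoint"
  by (simp add: selfadjoint_def star_mult star_star star_closed)

lemma eq_zero_if_nrm_le:
  assumes x: "x \<in> carrier C" and e: "\<And>n::nat. nrm C x \<le> e n" and "e \<longlonglongrightarrow> 0"
  shows "x = \<zero>"
proof -
  have "nrm C x \<le> 0" using assms by (intro LIMSEQ_le_const) auto
  with nrm_nonneg[OF x] x show ?thesis by (simp add: nrm_eq_0[symmetric])
qed

text \<open>The root is \<open>1 - y\<close>, where \<open>y\<close> is the fixed point of \<open>y \<mapsto> (b + y\<^sup>2) / 2\<close> in the ball of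
  radius \<open>\<parallel>b\<parallel>\<close>.\<close>
lemma sqrt_one_minus:
  assumes b: "b \<in> selfadjoint" and "nrm C b < 1"
  obtains d where "d \<in> selfadjoint" "d \<otimes> d = \<one> \<ominus> b"
proof -
  define r where "r = nrm C b"
  define f where "f y = emb (1/2) \<otimes> (b \<oplus> y \<otimes> y)" for y
  define M where "M = {y \<in> selfadjoint. nrm C y \<le> r}"
  note sc = selfadjoint_carrier
  have bc: "b \<in> carrier C" using b by (rule sc)
  have r: "0 \<le> r" "r < 1" using assms nrm_nonneg[OF bc] by (auto simp: r_def)
  have Mc: "x \<in> carrier C" if "x \<in> M" for x using that by (auto simp: M_def sc)
  have fM: "f x \<in> M" if x: "x \<in> M" for x
  proof -
    have "nrm C (f x) = 1/2 * nrm C (b \<oplus> x \<otimes> x)"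
      using nrm_emb_mult[of "b \<oplus> x \<otimes> x" "1/2"] bc Mc[OF x] by (simp add: f_def norm_divide)
    moreover have "nrm C (b \<oplus> x \<otimes> x) \<le> r + nrm C x * nrm C x"
      using nrm_triangle[of b "x \<otimes> x"] nrm_mult[of x x] bc Mc[OF x] by (simp add: r_def)
    moreover have "nrm C x * nrm C x \<le> r * 1"
      using x r nrm_nonneg[OF Mc[OF x]] by (intro mult_mono) (auto simp: M_def)
    ultimately have "nrm C (f x) \<le> r" by simp
    moreover have "f x \<in> selfadjoint"
      using x b selfadjoint_intros(1)[of "1/2"] by (auto simp: M_def f_def)
    ultimately show ?thesis by (simp add: M_def)
  qed
  \<comment> \<open>The difference of the squares is \<open>(x + y) (x - y)\<close> and
    \<open>x + y\<close> has norm at most \<open>2 r\<close> on \<open>M\<close>, so halving leaves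
    the Lipschitz constant \<open>r < 1\<close>.\<close>
  have contr: "nrm C (f x \<ominus> f y) \<le> r * nrm C (x \<ominus> y)" if x: "x \<in> M" and y: "y \<in> M" for x y
  proof -
    note [simp] = Mc[OF x] Mc[OF y] bc
    have "f x \<ominus> f y = emb (1/2) \<otimes> ((x \<oplus> y) \<otimes> (x \<ominus> y))"
      unfolding f_def using Mc[OF x] Mc[OF y] bc emb_closed[of "1/2"] by algebra
    then have "nrm C (f x \<ominus> f y) \<le> 1/2 * (nrm C (x \<oplus> y) * nrm C (x \<ominus> y))"
      using nrm_mult[of "x \<oplus> y" "x \<ominus> y"] by (simp add: nrm_emb_mult norm_divide)
    also have "\<dots> \<le> 1/2 * ((r + r) * nrm C (x \<ominus> y))"
      using nrm_triangle[of x y] x y by (intro mult_left_mono mult_right_mono nrm_nonneg) (auto simp: M_def)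
    finally show ?thesis by simp
  qed
  \<comment> \<open>\<open>Metric_space\<close> asks for nonnegativity and symmetry at all
    arguments, also outside \<open>M\<close>, hence the default value 0.\<close>
  define d where "d x y = (if x \<in> M \<and> y \<in> M then nrm C (x \<ominus> y) else 0)" for x y
  interpret M: Metric_space M d
  proof
    fix x y z assume *: "x \<in> M" "y \<in> M"
    then have [simp]: "x \<in> carrier C" "y \<in> carrier C" by (auto simp: Mc)
    show "d x y = 0 \<longleftrightarrow> x = y" using * by (simp add: nrm_eq_0 d_def right_minus_eq_zero)
    assume "z \<in> M" with * show "d x z \<le> d x y + d y z"
      by (simp add: nrm_minus_triangle Mc d_def)
  qed (simp_all add: d_def nrm_nonneg Mc nrm_minus_commute)
  have "M.mcomplete"
    unfolding M.mcomplete_def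
  proof (intro allI impI)
    fix s assume s: "M.MCauchy s"
    then have sM: "s n \<in> M" for n by (auto simp: M.MCauchy_def)
    have "\<exists>x\<in>carrier C. (\<lambda>n. nrm C (s n \<ominus> x)) \<longlonglongrightarrow> 0"
    proof (rule complete)
      show "range s \<subseteq> carrier C" using sM Mc by auto
      show "\<forall>\<epsilon>>0. \<exists>N. \<forall>m\<ge>N. \<forall>n\<ge>N. nrm C (s m \<ominus> s n) < \<epsilon>"
        using s sM unfolding M.MCauchy_def d_def by (simp; metis)
    qed
    then obtain x where x: "x \<in> carrier C" and lim: "(\<lambda>n. nrm C (s n \<ominus> x)) \<longlonglongrightarrow> 0" by blast
    note [simp] = x Mc[OF sM] star_closed
    \<comment> \<open>The involution is isometric, so the limit of selfadjoint elements is
      selfadjoint and stays in \<open>M\<close>.\<close>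
    have "star C x \<ominus> x = \<zero>"
    proof (rule eq_zero_if_nrm_le)
      fix n
      have "star C x \<ominus> s n = star C (x \<ominus> s n)"
        using sM[of n] by (simp add: star_minus M_def selfadjoint_def)
      then show "nrm C (star C x \<ominus> x) \<le> 2 * nrm C (s n \<ominus> x)"
        using nrm_minus_triangle[of "star C x" "s n" x] nrm_star[of "x \<ominus> s n"]
        by (simp add: nrm_minus_commute[of x])
    next
      show "(\<lambda>n. 2 * nrm C (s n \<ominus> x)) \<longlonglongrightarrow> 0" using tendsto_mult_left[OF lim, of 2] by simp
    qed simp
    then have "x \<in> selfadjoint" by (simp add: selfadjoint_def)
    moreover have "nrm C x \<le> r"
    proof (rule LIMSEQ_le_const)
      show "(\<lambda>n. nrm C (s n \<ominus> x) + r) \<longlonglongrightarrow> r" using tendsto_add[OF lim tendsto_const, of r] by simp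
      have "nrm C x \<le> nrm C (s n \<ominus> x) + r" for n
      proof -
        have "x = (x \<ominus> s n) \<oplus> s n" using x Mc[OF sM[of n]] by algebra
        then have "nrm C x \<le> nrm C (x \<ominus> s n) + nrm C (s n)"
          using nrm_triangle[of "x \<ominus> s n" "s n"] by simp
        then show ?thesis using sM[of n] by (simp add: M_def nrm_minus_commute[of x])
      qed
      then show "\<exists>N. \<forall>n\<ge>N. nrm C x \<le> nrm C (s n \<ominus> x) + r" by blast
    qed
    ultimately have xM: "x \<in> M" by (simp add: M_def)
    then have "limitin M.mtopology s x sequentially"
      using sM lim by (simp add: M.limitin_metric_dist_null d_def)
    then show "\<exists>x. limitin M.mtopology s x sequentially" by blast
  qed
  moreover have "M \<noteq> {}"
    using r selfadjoint_intros(1)[of 0] by (auto simp: M_def)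
  ultimately obtain y where y: "y \<in> M" "f y = y"
    using M.Banach_fixedpoint_thm[of f r] fM contr r by (auto simp: d_def)
  show ?thesis
  proof
    have [simp]: "y \<in> carrier C" using y Mc by blast
    show "\<one> \<ominus> y \<in> selfadjoint" using y by (auto simp: M_def)
    have "y \<oplus> y = emb 2 \<otimes> f y"
      unfolding y(2) using emb_add[of 1 1] by (simp add: l_distr)
    also have "\<dots> = (emb 2 \<otimes> emb (1/2)) \<otimes> (b \<oplus> y \<otimes> y)"
      by (simp add: f_def m_assoc bc)
    also have "\<dots> = b \<oplus> y \<otimes> y" by (simp add: emb_mult[symmetric] bc)
    finally have "y \<oplus> y = b \<oplus> y \<otimes> y" .
    moreover have "(\<one> \<ominus> y) \<otimes> (\<one> \<ominus> y) = \<one> \<ominus> (y \<oplus> y) \<oplus> y \<otimes> y"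
      using \<open>y \<in> carrier C\<close> by algebra
    ultimately have "(\<one> \<ominus> y) \<otimes> (\<one> \<ominus> y) = \<one> \<ominus> (b \<oplus> y \<otimes> y) \<oplus> y \<otimes> y" by simp
    also have "\<dots> = \<one> \<ominus> b" using \<open>y \<in> carrier C\<close> bc by algebra
    finally show "(\<one> \<ominus> y) \<otimes> (\<one> \<ominus> y) = \<one> \<ominus> b" .
  qed
qed

text \<open>Rescaling: \<open>M - b = M (1 - b / M)\<close>. A square lies in every cone, so this
  converts norm bounds into order bounds.\<close>

lemma sqrt_minus:
  assumes b: "b \<in> selfadjoint" and M: "nrm C b < M"
  obtains d where "d \<in> selfadjoint" "star C d \<otimes> d = emb (complex_of_real M) \<ominus> b"
proof -
  have bc [simp]: "b \<in> carrier C" using b by (rule selfadjoint_carrier)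
  have M0: "0 < M" using M nrm_nonneg[OF bc] by linarith
  have "nrm C (emb (complex_of_real (1/M)) \<otimes> b) < 1"
    using M M0 nrm_nonneg[OF bc] by (simp add: nrm_emb_mult norm_divide del: of_real_divide)
  then obtain d where d: "d \<in> selfadjoint" "d \<otimes> d = \<one> \<ominus> emb (complex_of_real (1/M)) \<otimes> b"
    using sqrt_one_minus[of "emb (complex_of_real (1/M)) \<otimes> b"] b selfadjoint_intros by blast
  define e where "e = emb (complex_of_real (sqrt M))"
  have dc: "d \<in> carrier C" and ec: "e \<in> carrier C" using d by (auto simp: selfadjoint_carrier e_def)
  have ee: "e \<otimes> e = emb (complex_of_real M)"
    using M0 by (simp add: e_def emb_mult[symmetric] del: of_real_mult flip: of_real_mult)
  have e1: "emb (complex_of_real M) \<otimes> emb (complex_of_real (1/M)) = \<one>"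
    using M0 by (simp add: emb_mult[symmetric])
  have "(e \<otimes> d) \<otimes> (e \<otimes> d) = (e \<otimes> e) \<otimes> (d \<otimes> d)" using dc ec by algebra
  also have "\<dots> = emb (complex_of_real M) \<ominus> (emb (complex_of_real M) \<otimes> emb (complex_of_real (1/M))) \<otimes> b"
    unfolding d(2) ee using bc emb_closed[of "complex_of_real M"] emb_closed[of "complex_of_real (1/M)"] by algebra
  also have "\<dots> = emb (complex_of_real M) \<ominus> b" unfolding e1 by simp
  finally show ?thesis
    using that[of "e \<otimes> d"] d by (simp add: e_def selfadjoint_star)
qed

section \<open>Cones and the value of a maximal cone\<close>

text \<open>A proper quadratic module, in the sense of real algebra, of the real commutative algebra
  of selfadjoint elements: for \<open>y = u + i v\<close> with u and v selfadjoint,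
  \<open>y^* y\<close> is the sum of the squares of u and v.\<close>

definition positive_cone :: "'c set \<Rightarrow> bool" where
  "positive_cone K \<longleftrightarrow> K \<subseteq> selfadjoint \<and> (\<forall>y\<in>carrier C. star C y \<otimes> y \<in> K) \<and>
     (\<forall>a\<in>K. \<forall>b\<in>K. a \<oplus> b \<in> K) \<and>
     (\<forall>a\<in>K. \<forall>y\<in>carrier C. star C y \<otimes> y \<otimes> a \<in> K) \<and> emb (-1) \<notin> K"

lemma emb_of_real_square: "0 \<le> r \<Longrightarrow>
   star C (emb (complex_of_real (sqrt r))) \<otimes> emb (complex_of_real (sqrt r)) = emb (complex_of_real r)"
  by (simp flip: emb_mult of_real_mult)

context
  fixes K
  assumes K: "positive_cone K"
begin

lemma cone_selfadjoint: "a \<in> K \<Longrightarrow> a \<in> selfadjoint" using K by (auto simp: positive_cone_def)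
lemma cone_carrier: "a \<in> K \<Longrightarrow> a \<in> carrier C" using cone_selfadjoint selfadjoint_carrier by blast
lemma cone_square: "y \<in> carrier C \<Longrightarrow> star C y \<otimes> y \<in> K" using K by (auto simp: positive_cone_def)
lemma cone_add: "a \<in> K \<Longrightarrow> b \<in> K \<Longrightarrow> a \<oplus> b \<in> K" using K by (auto simp: positive_cone_def)
lemma cone_mult_square: "a \<in> K \<Longrightarrow> y \<in> carrier C \<Longrightarrow> star C y \<otimes> y \<otimes> a \<in> K" using K by (auto simp: positive_cone_def)

lemma cone_emb: "0 \<le> r \<Longrightarrow> emb (complex_of_real r) \<in> K"
  using cone_square[of "emb (complex_of_real (sqrt r))"] emb_of_real_square by simp

lemma cone_scale: "0 \<le> r \<Longrightarrow> a \<in> K \<Longrightarrow> emb (complex_of_real r) \<otimes> a \<in> K"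
  using cone_mult_square[of a "emb (complex_of_real (sqrt r))"] emb_of_real_square by simp

lemma cone_not_negative: "r < 0 \<Longrightarrow> emb (complex_of_real r) \<notin> K"
proof
  assume r: "r < 0" and "emb (complex_of_real r) \<in> K"
  then have "emb (complex_of_real (- 1 / r)) \<otimes> emb (complex_of_real r) \<in> K"
    by (intro cone_scale) (auto simp: field_simps)
  with r have "emb (-1) \<in> K" by (simp add: emb_mult[symmetric])
  with K show False by (simp add: positive_cone_def)
qed

lemma cone_emb_iff: "emb (complex_of_real r) \<in> K \<longleftrightarrow> 0 \<le> r"
  using cone_emb cone_not_negative not_less by blast

lemma cone_norm_bound: "b \<in> selfadjoint \<Longrightarrow> nrm C b < M \<Longrightarrow> emb (complex_of_real M) \<ominus> b \<in> K"
  by (metis sqrt_minus selfadjoint_carrier cone_square)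

lemma cone_norm_bound': "b \<in> selfadjoint \<Longrightarrow> nrm C b < M \<Longrightarrow> emb (complex_of_real M) \<oplus> b \<in> K"
  using cone_norm_bound[of "\<ominus> b" M]
  by (simp add: selfadjoint_carrier nrm_uminus a_minus_def minus_minus)

text \<open>Any product with \<open>b\<close> selfadjoint is a difference of products with squares.\<close>
lemma cone_neg_cone_mult:
  assumes a: "a \<in> K" "\<ominus> a \<in> K" and b: "b \<in> selfadjoint"
  shows "a \<otimes> b \<in> K"
proof -
  let ?q = "emb (complex_of_real (1/4))"
  have [simp]: "a \<in> carrier C" "b \<in> carrier C" using a b by (auto simp: selfadjoint_carrier cone_carrier)
  let ?p = "b \<oplus> \<one>" and ?m = "b \<ominus> \<one>"
  \<comment> \<open>The identity is \<open>4 a b = (b + 1)^2 a + (b - 1)^2 (- a)\<close>, and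
    \<open>?q\<close> removes the factor 4.\<close>
  have "star C ?p \<otimes> ?p \<otimes> a \<oplus> star C ?m \<otimes> ?m \<otimes> (\<ominus> a) \<in> K"
    by (intro cone_add cone_mult_square a) auto
  then have "?q \<otimes> (star C ?p \<otimes> ?p \<otimes> a \<oplus> star C ?m \<otimes> ?m \<otimes> (\<ominus> a)) \<in> K"
    by (intro cone_scale) auto
  also have "star C ?p \<otimes> ?p \<otimes> a \<oplus> star C ?m \<otimes> ?m \<otimes> (\<ominus> a)
     = ?p \<otimes> ?p \<otimes> a \<oplus> ?m \<otimes> ?m \<otimes> (\<ominus> a)"
    using b by (simp add: selfadjoint_star)
  also have "\<dots> = (\<one> \<oplus> \<one> \<oplus> \<one> \<oplus> \<one>) \<otimes> (a \<otimes> b)"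
    using \<open>a \<in> carrier C\<close> \<open>b \<in> carrier C\<close> by algebra
  also have "\<one> \<oplus> \<one> \<oplus> \<one> \<oplus> \<one> = emb 4" using emb_add[of 1 1] emb_add[of 2 1] emb_add[of 3 1] by simp
  also have "?q \<otimes> (emb 4 \<otimes> (a \<otimes> b)) = (?q \<otimes> emb 4) \<otimes> (a \<otimes> b)" by (simp add: m_assoc)
  also have "?q \<otimes> emb 4 = \<one>" by (simp flip: emb_mult)
  finally show ?thesis by simp
qed

text \<open>The value at \<open>s\<close> of the character defined by a maximal cone is the infimum of the \<open>t\<close> with
  \<open>t - s \<in> K\<close>.\<close>
lemma maximal_cone_value:
  assumes max: "\<And>L. positive_cone L \<Longrightarrow> K \<subseteq> L \<Longrightarrow> L = K" and s: "s \<in> selfadjoint"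
  obtains l where "emb (complex_of_real l) \<ominus> s \<in> K" "\<ominus> (emb (complex_of_real l) \<ominus> s) \<in> K"
proof -
  define T where "T = {t. emb (complex_of_real t) \<ominus> s \<in> K}"
  define l where "l = Inf T"
  define a where "a = emb (complex_of_real l) \<ominus> s"
  have sc [simp]: "s \<in> carrier C" using s by (rule selfadjoint_carrier)
  have asa: "a \<in> selfadjoint" using s by (simp add: a_def)
  have ac [simp]: "a \<in> carrier C" using asa by (rule selfadjoint_carrier)
  have T1: "nrm C s + 1 \<in> T" using cone_norm_bound[OF s, of "nrm C s + 1"] by (simp add: T_def del: of_real_add)
  \<comment> \<open>For smaller \<open>t\<close>, both \<open>t - s\<close> and
    \<open>(- t - 1) + s\<close> would lie in \<open>K\<close>, and their sum is -1.\<close>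
  have Tlow: "- nrm C s - 1 \<le> t" if t: "t \<in> T" for t
  proof (rule ccontr)
    assume "\<not> ?thesis"
    then have "emb (complex_of_real (- t - 1)) \<oplus> s \<in> K" by (intro cone_norm_bound' s) simp
    with t have "(emb (complex_of_real t) \<ominus> s) \<oplus> (emb (complex_of_real (- t - 1)) \<oplus> s) \<in> K"
      by (intro cone_add[of "emb (complex_of_real t) \<ominus> s"]) (simp_all add: T_def)
    also have "(emb (complex_of_real t) \<ominus> s) \<oplus> (emb (complex_of_real (- t - 1)) \<oplus> s)
       = emb (complex_of_real t) \<oplus> emb (complex_of_real (- t - 1))"
      using sc emb_closed[of "complex_of_real t"] emb_closed[of "complex_of_real (- t - 1)"] by algebra
    also have "\<dots> = emb (complex_of_real (- 1))" by (simp flip: emb_add)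
    finally show False using cone_not_negative[of "-1"] by simp
  qed
  \<comment> \<open>The infimum is not yet known to be attained, so only positive shifts of
    \<open>a\<close> are available at this point.\<close>
  have a_eta: "emb (complex_of_real e) \<oplus> a \<in> K" if "e > 0" for e
  proof -
    have "Inf T < l + e" using that by (simp add: l_def)
    then obtain t where t: "t \<in> T" "t < l + e"
      using T1 cInf_lessD[of T "l + e"] by blast
    then have "emb (complex_of_real (l + e - t)) \<oplus> (emb (complex_of_real t) \<ominus> s) \<in> K"
      by (intro cone_add cone_emb) (auto simp: T_def)
    also have "emb (complex_of_real (l + e - t)) \<oplus> (emb (complex_of_real t) \<ominus> s) =
      (emb (complex_of_real (l + e - t)) \<oplus> emb (complex_of_real t)) \<ominus> s"
      by (simp add: a_minus_def a_assoc)
    also have "emb (complex_of_real (l + e - t)) \<oplus> emb (complex_of_real t) =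
       emb (complex_of_real e) \<oplus> emb (complex_of_real l)"
      by (simp add: add.commute flip: emb_add)
    finally show ?thesis by (simp add: a_def a_minus_def a_assoc)
  qed
  have not_a: "emb (complex_of_real e) \<oplus> a \<notin> K" if "e < 0" for e
  proof
    assume "emb (complex_of_real e) \<oplus> a \<in> K"
    moreover have "emb (complex_of_real e) \<oplus> a =
       (emb (complex_of_real e) \<oplus> emb (complex_of_real l)) \<ominus> s"
      by (simp add: a_def a_minus_def a_assoc)
    ultimately have "l + e \<in> T" by (simp add: T_def emb_add add.commute)
    then have "l \<le> l + e" unfolding l_def using Tlow by (intro cInf_lower bdd_belowI) auto
    with that show False by simp
  qed
  \<comment> \<open>\<open>K\<close> enlarged by all selfadjoint multiples of \<open>a\<close>, so
    that both \<open>a\<close> and its negative belong to \<open>L\<close>. The closure properties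
    are inherited; once -1 is excluded, maximality gives \<open>L = K\<close>.\<close>
  define L where "L = {k \<oplus> a \<otimes> x |k x. k \<in> K \<and> x \<in> selfadjoint}"
  have KL: "K \<subseteq> L"
  proof
    fix k assume k: "k \<in> K"
    have "k = k \<oplus> a \<otimes> \<zero>" using cone_carrier[OF k] by simp
    then show "k \<in> L" using k selfadjoint_intros(1)[of 0] unfolding L_def
      by (intro CollectI exI[of _ k] exI[of _ \<zero>]) simp
  qed
  have "positive_cone L"
    unfolding positive_cone_def
  proof (intro conjI ballI)
    show "L \<subseteq> selfadjoint" using asa by (auto simp: L_def cone_selfadjoint)
    show "star C y \<otimes> y \<in> L" if "y \<in> carrier C" for y
      using cone_square[OF that] KL by blast
    show "u \<oplus> v \<in> L" if "u \<in> L" "v \<in> L" for u v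
    proof -
      from that obtain k x j y where *: "k \<in> K" "x \<in> selfadjoint" "j \<in> K" "y \<in> selfadjoint"
        and uv: "u = k \<oplus> a \<otimes> x" "v = j \<oplus> a \<otimes> y" by (auto simp: L_def)
      have "u \<oplus> v = (k \<oplus> j) \<oplus> a \<otimes> (x \<oplus> y)" unfolding uv
        using ac cone_carrier[OF *(1)] cone_carrier[OF *(3)]
         selfadjoint_carrier[OF *(2)] selfadjoint_carrier[OF *(4)] by algebra
      with * show ?thesis unfolding L_def using cone_add by blast
    qed
    show "star C y \<otimes> y \<otimes> u \<in> L" if "u \<in> L" "y \<in> carrier C" for u y
    proof -
      from that obtain k x where *: "k \<in> K" "x \<in> selfadjoint" and u: "u = k \<oplus> a \<otimes> x" by (auto simp: L_def)
      define z where "z = star C y \<otimes> y"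
      have z: "z \<in> selfadjoint" using that by (simp add: z_def)
      have "z \<otimes> u = z \<otimes> k \<oplus> a \<otimes> (z \<otimes> x)" unfolding u
        using ac cone_carrier[OF *(1)] selfadjoint_carrier[OF *(2)] selfadjoint_carrier[OF z] by algebra
      moreover have "z \<otimes> k \<in> K" unfolding z_def by (intro cone_mult_square * that)
      ultimately show ?thesis unfolding L_def z_def[symmetric] using * z by blast
    qed
    show "emb (-1) \<notin> L"
    proof
      assume "emb (-1) \<in> L"
      then obtain k x where *: "k \<in> K" "x \<in> selfadjoint" and u: "emb (-1) = k \<oplus> a \<otimes> x" by (auto simp: L_def)
      have kx [simp]: "k \<in> carrier C" "x \<in> carrier C" using * by (auto simp: cone_carrier selfadjoint_carrier)
      \<comment> \<open>Adding \<open>(M + x) (e + a)\<close> and \<open>e (M - x)\<close> to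
        \<open>k + a x = -1\<close> gives \<open>M a + 2 e M - 1\<close>. The choice
        \<open>e = 1 / (4 M)\<close> makes this \<open>M a - 1/2\<close>, so
        \<open>a - 1 / (2 M)\<close> would lie in \<open>K\<close>, against \<open>not_a\<close>. As
        \<open>M\<close> exceeds the norm of \<open>x\<close>, both \<open>M + x\<close> and
        \<open>M - x\<close> are squares.\<close>
      define M where "M = nrm C x + 1"
      have M: "M > 0" using nrm_nonneg[OF kx(2)] by (simp add: M_def)
      define e where "e = 1 / (4 * M)"
      have e: "e > 0" using M by (simp add: e_def)
      \<comment> \<open>Cones are closed under multiplication by squares, not under products, so
        \<open>M + x\<close> is written as \<open>d^* d\<close> before it multiplies
        \<open>e + a\<close>.\<close>
      obtain d where d: "d \<in> selfadjoint" "star C d \<otimes> d = emb (complex_of_real M) \<oplus> x"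
      proof -
        have "nrm C (\<ominus> x) < M" by (simp add: nrm_uminus M_def)
        then obtain d where "d \<in> selfadjoint" "star C d \<otimes> d = emb (complex_of_real M) \<ominus> (\<ominus> x)"
          using sqrt_minus[of "\<ominus> x" M] * by blast
        then show ?thesis using that[of d] by (simp add: a_minus_def minus_minus)
      qed
      define m where "m = emb (complex_of_real M)"
      define ee where "ee = emb (complex_of_real e)"
      have [simp]: "m \<in> carrier C" "ee \<in> carrier C" by (auto simp: m_def ee_def)
      have 1: "(m \<oplus> x) \<otimes> (ee \<oplus> a) \<in> K"
        using cone_mult_square[OF a_eta[OF e] selfadjoint_carrier[OF d(1)]] by (simp add: d m_def ee_def)
      have 2: "ee \<otimes> (m \<ominus> x) \<in> K"
        unfolding ee_def m_def by (intro cone_scale cone_norm_bound *) (use e in \<open>auto simp: M_def\<close>)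
      have "k \<oplus> (m \<oplus> x) \<otimes> (ee \<oplus> a) \<oplus> ee \<otimes> (m \<ominus> x) \<in> K"
        by (intro cone_add 1 2 *)
      also have "k \<oplus> (m \<oplus> x) \<otimes> (ee \<oplus> a) \<oplus> ee \<otimes> (m \<ominus> x) = (k \<oplus> a \<otimes> x) \<oplus> m \<otimes> a \<oplus> (ee \<otimes> m \<oplus> ee \<otimes> m)"
        using kx ac \<open>m \<in> carrier C\<close> \<open>ee \<in> carrier C\<close> by algebra
      also have "\<dots> = m \<otimes> a \<oplus> (emb (-1) \<oplus> (ee \<otimes> m \<oplus> ee \<otimes> m))"
        unfolding u[symmetric] using kx ac \<open>m \<in> carrier C\<close> \<open>ee \<in> carrier C\<close> emb_closed[of "-1"] by algebra
      also have "emb (-1) \<oplus> (ee \<otimes> m \<oplus> ee \<otimes> m) = emb (complex_of_real (-1/2))"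
        using M by (simp add: ee_def m_def e_def flip: emb_add emb_mult)
      finally have "emb (complex_of_real (1/M)) \<otimes> (m \<otimes> a \<oplus> emb (complex_of_real (-1/2))) \<in> K"
        using M by (intro cone_scale) auto
      also have "emb (complex_of_real (1/M)) \<otimes> (m \<otimes> a \<oplus> emb (complex_of_real (-1/2))) =
         (emb (complex_of_real (1/M)) \<otimes> m) \<otimes> a \<oplus> emb (complex_of_real (1/M)) \<otimes> emb (complex_of_real (-1/2))"
        by (simp add: r_distr m_assoc)
      also have "\<dots> = emb (complex_of_real (- 1/(2*M))) \<oplus> a"
        using M by (simp add: m_def a_comm mult.commute flip: emb_mult)
      finally show False using not_a[of "- 1/(2*M)"] M by simp
    qed
  qed
  then have LK: "L = K" using KL by (rule max)
  have "\<zero> \<in> K" using cone_emb[of 0] by simp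
  then have "\<zero> \<oplus> a \<otimes> \<one> \<in> L" "\<zero> \<oplus> a \<otimes> (\<ominus> \<one>) \<in> L" unfolding L_def by blast+
  then have "a \<in> K" "\<ominus> a \<in> K" unfolding LK by (simp_all add: r_minus)
  then show ?thesis using that[of l] by (simp add: a_def)
qed

end

text \<open>Zorn's lemma: a sum involves two elements, which lie in a common member of the chain,
  and -1 lies in no member.\<close>

lemma maximal_cone_exists:
  assumes K0: "positive_cone K0"
  obtains K where "positive_cone K" "K0 \<subseteq> K" "\<And>L. positive_cone L \<Longrightarrow> K \<subseteq> L \<Longrightarrow> L = K"
proof -
  define F where "F = {K. positive_cone K \<and> K0 \<subseteq> K}"
  have "\<exists>K\<in>F. \<forall>L\<in>F. K \<subseteq> L \<longrightarrow> L = K"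
  proof (rule subset_Zorn_nonempty)
    show "F \<noteq> {}" using K0 by (auto simp: F_def)
    fix \<C> assume ne: "\<C> \<noteq> {}" and ch: "subset.chain F \<C>"
    have F: "K \<in> F" if "K \<in> \<C>" for K using ch that by (auto simp: subset_chain_def)
    have lin: "K \<subseteq> L \<or> L \<subseteq> K" if "K \<in> \<C>" "L \<in> \<C>" for K L using ch that by (auto simp: subset_chain_def)
    have pc: "positive_cone K" if "K \<in> \<C>" for K using F[OF that] by (simp add: F_def)
    have "positive_cone (\<Union>\<C>)"
      unfolding positive_cone_def
    proof (intro conjI ballI)
      show "\<Union>\<C> \<subseteq> selfadjoint" using cone_selfadjoint[OF pc] by blast
      show "star C y \<otimes> y \<in> \<Union>\<C>" if "y \<in> carrier C" for y
        using cone_square[OF pc] that ne by blast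
      show "a \<oplus> b \<in> \<Union>\<C>" if "a \<in> \<Union>\<C>" "b \<in> \<Union>\<C>" for a b
      proof -
        from that obtain K L where "K \<in> \<C>" "L \<in> \<C>" "a \<in> K" "b \<in> L" by blast
        with lin[of K L] show ?thesis using cone_add[OF pc[of K], of a b] cone_add[OF pc[of L], of a b] by blast
      qed
      show "star C y \<otimes> y \<otimes> a \<in> \<Union>\<C>" if "a \<in> \<Union>\<C>" "y \<in> carrier C" for a y
        using that cone_mult_square[OF pc] by blast
      show "emb (-1) \<notin> \<Union>\<C>" using pc by (auto simp: positive_cone_def)
    qed
    then show "\<Union>\<C> \<in> F" using F ne by (auto simp: F_def)
  qed
  then obtain K where "K \<in> F" and K: "\<And>L. L \<in> F \<Longrightarrow> K \<subseteq> L \<Longrightarrow> L = K" by blast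
  then show ?thesis by (intro that[of K]) (auto simp: F_def)
qed

lemma selfadjoint_decomposition:
  assumes x: "x \<in> carrier C"
  obtains u v where "u \<in> selfadjoint" "v \<in> selfadjoint" "x = u \<oplus> emb \<i> \<otimes> v"
proof
  let ?h = "emb (1/2)" and ?k = "emb (- \<i> / 2)" and ?y = "star C x"
  have [simp]: "?y \<in> carrier C" using x by (rule star_closed)
  show "?h \<otimes> (x \<oplus> ?y) \<in> selfadjoint" using x
    by (simp add: selfadjoint_def star_mult' star_emb star_add star_star a_comm)
  have e: "emb (\<i>/2) = \<ominus> ?k" by (simp flip: emb_uminus)
  show "?k \<otimes> (x \<ominus> ?y) \<in> selfadjoint" using x
    by (simp add: selfadjoint_def star_mult' star_emb star_minus star_star e)
      (simp add: a_minus_def r_distr l_minus r_minus minus_minus a_comm)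
  have "emb \<i> \<otimes> (?k \<otimes> (x \<ominus> ?y)) = (emb \<i> \<otimes> ?k) \<otimes> (x \<ominus> ?y)"
    using x by (simp add: m_assoc)
  also have "emb \<i> \<otimes> ?k = ?h" by (simp flip: emb_mult)
  finally have "?h \<otimes> (x \<oplus> ?y) \<oplus> emb \<i> \<otimes> (?k \<otimes> (x \<ominus> ?y)) = ?h \<otimes> (x \<oplus> ?y) \<oplus> ?h \<otimes> (x \<ominus> ?y)"
    by simp
  also have "\<dots> = (?h \<oplus> ?h) \<otimes> x" using x \<open>?y \<in> carrier C\<close> emb_closed[of "1/2"] by algebra
  also have "?h \<oplus> ?h = \<one>" by (simp flip: emb_add)
  finally show "x = ?h \<otimes> (x \<oplus> ?y) \<oplus> emb \<i> \<otimes> (?k \<otimes> (x \<ominus> ?y))" using x by simp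
qed

section \<open>The kernel of a cone\<close>

context
  fixes K
  assumes K: "positive_cone K"
begin

text \<open>Since \<open>x^* x\<close> always lies in \<open>K\<close>, the condition puts it into
  the intersection of \<open>K\<close> and \<open>-K\<close>. For maximal \<open>K\<close> this is
  the kernel of the character.\<close>

definition cone_kernel :: "'c set" where
  "cone_kernel = {x \<in> carrier C. \<ominus> (star C x \<otimes> x) \<in> K}"

lemma cone_kernel_carrier: "x \<in> cone_kernel \<Longrightarrow> x \<in> carrier C"
  by (simp add: cone_kernel_def)

lemma cone_kernel_star: "x \<in> cone_kernel \<Longrightarrow> star C x \<in> cone_kernel"
  by (simp add: cone_kernel_def star_closed star_star m_comm[of x "star C x"])

lemma cone_kernel_mult: "x \<in> cone_kernel \<Longrightarrow> y \<in> carrier C \<Longrightarrow> y \<otimes> x \<in> cone_kernel"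
proof -
  assume x: "x \<in> cone_kernel" and y: "y \<in> carrier C"
  have c: "x \<in> carrier C" "star C x \<in> carrier C" "star C y \<in> carrier C"
    using x y by (auto simp: cone_kernel_def star_closed)
  have "star C y \<otimes> y \<otimes> (\<ominus> (star C x \<otimes> x)) \<in> K"
    using x y by (intro cone_mult_square[OF K]) (auto simp: cone_kernel_def)
  also have "star C y \<otimes> y \<otimes> (\<ominus> (star C x \<otimes> x)) = \<ominus> (star C (y \<otimes> x) \<otimes> (y \<otimes> x))"
    using c y by (simp only: star_mult') algebra
  finally show ?thesis using c y by (simp add: cone_kernel_def)
qed

text \<open>Parallelogram law.\<close>
lemma cone_kernel_add: "x \<in> cone_kernel \<Longrightarrow> y \<in> cone_kernel \<Longrightarrow> x \<oplus> y \<in> cone_kernel"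
proof -
  assume x: "x \<in> cone_kernel" and y: "y \<in> cone_kernel"
  have c: "x \<in> carrier C" "star C x \<in> carrier C" "y \<in> carrier C" "star C y \<in> carrier C"
    using x y by (auto simp: cone_kernel_def star_closed)
  let ?a = "\<ominus> (star C x \<otimes> x)" and ?b = "\<ominus> (star C y \<otimes> y)"
  have "?a \<oplus> ?a \<oplus> (?b \<oplus> ?b) \<oplus> star C (x \<ominus> y) \<otimes> (x \<ominus> y) \<in> K"
    using x y by (intro cone_add[OF K] cone_square[OF K]) (auto simp: cone_kernel_def)
  also have "?a \<oplus> ?a \<oplus> (?b \<oplus> ?b) \<oplus> star C (x \<ominus> y) \<otimes> (x \<ominus> y)
     = \<ominus> (star C (x \<oplus> y) \<otimes> (x \<oplus> y))"
    using c by (simp only: star_minus star_add) algebra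
  finally show ?thesis using c by (simp add: cone_kernel_def)
qed

lemma cone_kernel_minus: "x \<in> cone_kernel \<Longrightarrow> y \<in> cone_kernel \<Longrightarrow> x \<ominus> y \<in> cone_kernel"
  using cone_kernel_add[of x "emb (-1) \<otimes> y"] cone_kernel_mult[of y "emb (-1)"]
  by (simp add: emb_uminus a_minus_def l_minus cone_kernel_carrier)

text \<open>The ideal is proper, because a cone contains no negative scalar. This makes the scalar
  congruent to a given element unique.\<close>

lemma cone_kernel_emb: "emb z \<in> cone_kernel \<Longrightarrow> z = 0"
proof -
  assume "emb z \<in> cone_kernel"
  then have "\<ominus> (emb (cnj z) \<otimes> emb z) \<in> K" by (simp add: cone_kernel_def star_emb)
  also have "\<ominus> (emb (cnj z) \<otimes> emb z) = emb (complex_of_real (- (cmod z)\<^sup>2))"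
    by (simp only: emb_mult[symmetric] emb_uminus[symmetric] of_real_minus complex_norm_square mult.commute)
  finally show ?thesis by (simp only: cone_emb_iff[OF K]) simp
qed

text \<open>Here \<open>a^* a\<close> is the square of \<open>a\<close>, and
  \<open>cone_neg_cone_mult\<close> multiplies \<open>- a\<close> by the selfadjoint element
  \<open>a\<close>.\<close>

lemma cone_kernelI: "a \<in> K \<Longrightarrow> \<ominus> a \<in> K \<Longrightarrow> a \<in> cone_kernel"
proof -
  assume a: "a \<in> K" "\<ominus> a \<in> K"
  have sa: "a \<in> selfadjoint" using a cone_selfadjoint[OF K] by blast
  then have c: "a \<in> carrier C" by (rule selfadjoint_carrier)
  have "\<ominus> a \<otimes> a \<in> K" using cone_neg_cone_mult[OF K a(2) _ sa] a c by simp
  with sa c show ?thesis by (simp add: cone_kernel_def selfadjoint_star l_minus)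
qed

text \<open>Modulo the kernel every element is a scalar, so the quotient is the field of complex
  numbers. \<open>maximal_cone_value\<close> settles the real and the imaginary part
  separately.\<close>

lemma maximal_cone_kernel_value:
  assumes max: "\<And>L. positive_cone L \<Longrightarrow> K \<subseteq> L \<Longrightarrow> L = K" and x: "x \<in> carrier C"
  obtains z where "x \<ominus> emb z \<in> cone_kernel"
proof -
  have sa: "\<exists>l. s \<ominus> emb (complex_of_real l) \<in> cone_kernel" if s: "s \<in> selfadjoint" for s
  proof -
    obtain l where "emb (complex_of_real l) \<ominus> s \<in> K" "\<ominus> (emb (complex_of_real l) \<ominus> s) \<in> K"
      using maximal_cone_value[OF K max s] by blast
    moreover have "\<ominus> (emb (complex_of_real l) \<ominus> s) = s \<ominus> emb (complex_of_real l)"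
      "\<ominus> (s \<ominus> emb (complex_of_real l)) = emb (complex_of_real l) \<ominus> s"
      using selfadjoint_carrier[OF s] emb_closed[of "complex_of_real l"] by algebra+
    ultimately show ?thesis using cone_kernelI[of "s \<ominus> emb (complex_of_real l)"] by auto
  qed
  obtain u v where uv: "u \<in> selfadjoint" "v \<in> selfadjoint" "x = u \<oplus> emb \<i> \<otimes> v"
    using selfadjoint_decomposition[OF x] by blast
  then obtain l m where lm: "u \<ominus> emb (complex_of_real l) \<in> cone_kernel" "v \<ominus> emb (complex_of_real m) \<in> cone_kernel"
    using sa by blast
  have "(u \<ominus> emb (complex_of_real l)) \<oplus> emb \<i> \<otimes> (v \<ominus> emb (complex_of_real m)) \<in> cone_kernel"
    by (intro cone_kernel_add cone_kernel_mult lm) simp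
  also have "(u \<ominus> emb (complex_of_real l)) \<oplus> emb \<i> \<otimes> (v \<ominus> emb (complex_of_real m))
     = x \<ominus> (emb (complex_of_real l) \<oplus> emb \<i> \<otimes> emb (complex_of_real m))"
    unfolding uv(3) using uv(1,2)[THEN selfadjoint_carrier] emb_closed[of "complex_of_real l"] emb_closed[of "complex_of_real m"] emb_closed[of \<i>] by algebra
  finally show ?thesis using that by (simp flip: emb_add emb_mult)
qed

end

section \<open>Characters, and one in the support of a state\<close>

text \<open>The last clause contains unitality and, together with multiplicativity, complex
  homogeneity.\<close>

definition character :: "('c \<Rightarrow> complex) \<Rightarrow> bool" where
  "character \<phi> \<longleftrightarrow>
     (\<forall>x\<in>carrier C. \<forall>y\<in>carrier C. \<phi> (x \<oplus> y) = \<phi> x + \<phi> y) \<and>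
     (\<forall>x\<in>carrier C. \<forall>y\<in>carrier C. \<phi> (x \<otimes> y) = \<phi> x * \<phi> y) \<and>
     (\<forall>x\<in>carrier C. \<phi> (star C x) = cnj (\<phi> x)) \<and> (\<forall>c. \<phi> (emb c) = c)"

text \<open>The character is the residue modulo the kernel of a maximal cone above
  \<open>K0\<close>. Kernels grow with the cone, so the elements singled out by \<open>K0\<close>
  are annihilated.\<close>

lemma cone_character:
  assumes K0: "positive_cone K0"
  obtains \<phi> where "character \<phi>" "\<And>x. x \<in> carrier C \<Longrightarrow> \<ominus> (star C x \<otimes> x) \<in> K0 \<Longrightarrow> \<phi> x = 0"
proof -
  obtain K where K: "positive_cone K" and "K0 \<subseteq> K" and max: "\<And>L. positive_cone L \<Longrightarrow> K \<subseteq> L \<Longrightarrow> L = K"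
    using maximal_cone_exists[OF K0] by blast
  let ?N = "cone_kernel K"
  define \<phi> where "\<phi> x = (SOME z. x \<ominus> emb z \<in> ?N)" for x
  have chi: "x \<ominus> emb (\<phi> x) \<in> ?N" if "x \<in> carrier C" for x
    using maximal_cone_kernel_value[OF K max that] unfolding \<phi>_def by (metis someI_ex)
  have unique: "\<phi> x = z" if x: "x \<in> carrier C" and z: "x \<ominus> emb z \<in> ?N" for x z
  proof -
    have "(x \<ominus> emb z) \<ominus> (x \<ominus> emb (\<phi> x)) \<in> ?N" by (rule cone_kernel_minus[OF K z chi[OF x]])
    also have "(x \<ominus> emb z) \<ominus> (x \<ominus> emb (\<phi> x)) = emb (\<phi> x) \<ominus> emb z"
      using x emb_closed[of z] emb_closed[of "\<phi> x"] by algebra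
    finally show ?thesis using cone_kernel_emb[OF K, of "\<phi> x - z"] by (simp add: emb_diff)
  qed
  show ?thesis
  proof
    show "character \<phi>"
      unfolding character_def
    proof (intro conjI ballI allI)
      fix x y assume xy: "x \<in> carrier C" "y \<in> carrier C"
      note c = xy emb_closed[of "\<phi> x"] emb_closed[of "\<phi> y"]
      show "\<phi> (x \<oplus> y) = \<phi> x + \<phi> y"
      proof (rule unique)
        have "(x \<ominus> emb (\<phi> x)) \<oplus> (y \<ominus> emb (\<phi> y)) \<in> ?N" by (intro cone_kernel_add[OF K] chi xy)
        also have "(x \<ominus> emb (\<phi> x)) \<oplus> (y \<ominus> emb (\<phi> y)) = (x \<oplus> y) \<ominus> emb (\<phi> x + \<phi> y)"
          unfolding emb_add using c by algebra
        finally show "(x \<oplus> y) \<ominus> emb (\<phi> x + \<phi> y) \<in> ?N" .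
      qed (use xy in simp)
      show "\<phi> (x \<otimes> y) = \<phi> x * \<phi> y"
      proof (rule unique)
        \<comment> \<open>With f for the character,
          \<open>x y - f(x) f(y) = y (x - f(x)) + f(x) (y - f(y))\<close>, a combination of kernel
          elements.\<close>
        have "y \<otimes> (x \<ominus> emb (\<phi> x)) \<oplus> emb (\<phi> x) \<otimes> (y \<ominus> emb (\<phi> y)) \<in> ?N"
          by (intro cone_kernel_add[OF K] cone_kernel_mult[OF K] chi xy) simp
        also have "y \<otimes> (x \<ominus> emb (\<phi> x)) \<oplus> emb (\<phi> x) \<otimes> (y \<ominus> emb (\<phi> y)) = (x \<otimes> y) \<ominus> emb (\<phi> x * \<phi> y)"
          unfolding emb_mult using c by algebra
        finally show "(x \<otimes> y) \<ominus> emb (\<phi> x * \<phi> y) \<in> ?N" .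
      qed (use xy in simp)
      show "\<phi> (star C x) = cnj (\<phi> x)"
        using cone_kernel_star[OF K chi[OF xy(1)]] xy
        by (intro unique) (auto simp: star_minus star_emb star_closed)
    next
      \<comment> \<open>Multiplying some kernel element by zero shows that zero is in the kernel,
        and \<open>emb c\<close> minus itself is zero.\<close>
      fix c show "\<phi> (emb c) = c"
        using chi[of \<zero>] unique[of "emb c" c] cone_kernel_mult[OF K chi[of \<zero>], of \<zero>]
          by (simp add: a_minus_def r_neg)
    qed
    show "\<phi> x = 0" if "x \<in> carrier C" "\<ominus> (star C x \<otimes> x) \<in> K0" for x
      using that \<open>K0 \<subseteq> K\<close> by (intro unique) (auto simp: cone_kernel_def[OF K] a_minus_def)
  qed
qed

lemma characterD:
  assumes "character \<phi>"
  shows "x \<in> carrier C \<Longrightarrow> y \<in> carrier C \<Longrightarrow> \<phi> (x \<oplus> y) = \<phi> x + \<phi> y"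
    "x \<in> carrier C \<Longrightarrow> y \<in> carrier C \<Longrightarrow> \<phi> (x \<otimes> y) = \<phi> x * \<phi> y"
    "x \<in> carrier C \<Longrightarrow> \<phi> (star C x) = cnj (\<phi> x)"
    "\<phi> (emb c) = c"
  using assms by (auto simp: character_def)

text \<open>The cone of all \<open>a\<close> that are nonnegative for every functional \<open>x \<mapsto> \<tau> (f\<^sup>* f x)\<close> contains
  \<open>- x\<^sup>* x\<close> whenever \<open>\<tau> (x\<^sup>* x) = 0\<close>.\<close>
lemma state_character:
  assumes st: "cstar_state C \<tau>"
  obtains \<phi> where "character \<phi>" "\<And>x. x \<in> carrier C \<Longrightarrow> \<tau> (star C x \<otimes> x) = 0 \<Longrightarrow> \<phi> x = 0"
proof -
  have add: "\<tau> (x \<oplus> y) = \<tau> x + \<tau> y" if "x \<in> carrier C" "y \<in> carrier C" for x y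
    using st that by (auto simp: cstar_state_def)
  have scale: "\<tau> (emb c \<otimes> x) = c * \<tau> x" if "x \<in> carrier C" for x c
    using st that by (auto simp: cstar_state_def emb_mult_eq_smult)
  have pos: "\<tau> (star C x \<otimes> x) \<in> \<real>\<^sub>\<ge>\<^sub>0" if "x \<in> carrier C" for x
    using st that by (auto simp: cstar_state_def)
  have one: "\<tau> \<one> = 1" using st by (auto simp: cstar_state_def)
  have neg: "\<tau> (\<ominus> x) = - \<tau> x" if "x \<in> carrier C" for x
    using scale[OF that, of "-1"] that by (simp add: emb_uminus l_minus)
  have pos2: "\<tau> (star C f \<otimes> f \<otimes> (star C x \<otimes> x)) \<in> \<real>\<^sub>\<ge>\<^sub>0" if "f \<in> carrier C" "x \<in> carrier C" for f x
  proof -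
    have "star C f \<otimes> f \<otimes> (star C x \<otimes> x) = star C (f \<otimes> x) \<otimes> (f \<otimes> x)"
      using that that[THEN star_closed] by (simp only: star_mult') algebra
    with pos[of "f \<otimes> x"] that show ?thesis by simp
  qed
  \<comment> \<open>The condition that the state be nonnegative at \<open>a\<close> alone need not
    survive multiplication by squares; quantifying over \<open>f\<close> builds this in, and
    \<open>f = 1\<close> excludes -1.\<close>
  define K where "K = {a \<in> selfadjoint. \<forall>f\<in>carrier C. \<tau> (star C f \<otimes> f \<otimes> a) \<in> \<real>\<^sub>\<ge>\<^sub>0}"
  have Kc: "a \<in> carrier C" if "a \<in> K" for a using that by (auto simp: K_def selfadjoint_carrier)
  have "positive_cone K"
    unfolding positive_cone_def
  proof (intro conjI ballI)
    show "K \<subseteq> selfadjoint" by (auto simp: K_def)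
    show "star C y \<otimes> y \<in> K" if "y \<in> carrier C" for y using pos2 that by (simp add: K_def)
    show "a \<oplus> b \<in> K" if "a \<in> K" "b \<in> K" for a b
      using that Kc[OF that(1)] Kc[OF that(2)]
      by (auto simp: K_def r_distr add star_closed intro!: nonneg_Reals_add_I)
    show "star C y \<otimes> y \<otimes> a \<in> K" if "a \<in> K" "y \<in> carrier C" for a y
    proof -
      have "\<tau> (star C f \<otimes> f \<otimes> (star C y \<otimes> y \<otimes> a)) \<in> \<real>\<^sub>\<ge>\<^sub>0" if f: "f \<in> carrier C" for f
      proof -
        have "star C f \<otimes> f \<otimes> (star C y \<otimes> y \<otimes> a) = star C (f \<otimes> y) \<otimes> (f \<otimes> y) \<otimes> a"
          using f \<open>y \<in> carrier C\<close> star_closed[OF f] star_closed[OF \<open>y \<in> carrier C\<close>] Kc[OF \<open>a \<in> K\<close>]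
          by (simp only: star_mult') algebra
        then show ?thesis using \<open>a \<in> K\<close> f \<open>y \<in> carrier C\<close> by (simp add: K_def)
      qed
      then show ?thesis using that by (auto simp: K_def)
    qed
    show "emb (-1) \<notin> K"
    proof
      assume "emb (-1) \<in> K"
      then have "\<tau> (star C \<one> \<otimes> \<one> \<otimes> emb (-1)) \<in> \<real>\<^sub>\<ge>\<^sub>0"
        using one_closed unfolding K_def by blast
      then show False using scale[of \<one> "-1"] one by simp
    qed
  qed
  then obtain \<phi> where phi: "character \<phi>"
    and ker: "\<And>x. x \<in> carrier C \<Longrightarrow> \<ominus> (star C x \<otimes> x) \<in> K \<Longrightarrow> \<phi> x = 0"
    using cone_character by blast
  show ?thesis
  proof (rule that[OF phi], rule ker)
    fix x assume x: "x \<in> carrier C" and t0: "\<tau> (star C x \<otimes> x) = 0"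
    define q where "q = star C x \<otimes> x"
    have qc [simp]: "q \<in> carrier C" using x by (simp add: q_def star_closed)
    have "\<tau> (star C f \<otimes> f \<otimes> q) = 0" if f: "f \<in> carrier C" for f
    proof -
      \<comment> \<open>With \<open>M - f^* f = d^* d\<close>, the values of the state at
        \<open>f^* f q\<close> and \<open>d^* d q\<close> are nonnegative and add up to
        \<open>M\<close> times its value at \<open>q\<close>, which is 0; hence both vanish.\<close>
      obtain M where M: "nrm C (star C f \<otimes> f) < M" using gt_ex by blast
      then obtain d where d: "d \<in> selfadjoint" "star C d \<otimes> d = emb (complex_of_real M) \<ominus> star C f \<otimes> f"
        using sqrt_minus f by blast
      have "star C f \<otimes> f \<otimes> q \<oplus> star C d \<otimes> d \<otimes> q = emb (complex_of_real M) \<otimes> q"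
        unfolding d(2) using f star_closed[OF f] qc emb_closed[of "complex_of_real M"] by algebra
      then have "\<tau> (star C f \<otimes> f \<otimes> q) + \<tau> (star C d \<otimes> d \<otimes> q) = 0"
        using add[of "star C f \<otimes> f \<otimes> q" "star C d \<otimes> d \<otimes> q"] f selfadjoint_carrier[OF d(1)] t0
          scale[OF qc, of "complex_of_real M"]
        by (simp add: star_closed q_def[symmetric])
      then show ?thesis
        using pos2[OF f x] pos2[OF selfadjoint_carrier[OF d(1)] x] nonneg_Reals_add_eq_0D
        unfolding q_def by blast
    qed
    then have "\<ominus> q \<in> K" using x by (auto simp: K_def r_minus neg star_closed q_def)
    then show "\<ominus> (star C x \<otimes> x) \<in> K" by (simp add: q_def)
  qed
qed

section \<open>Finite sums and linear combinations\<close>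

lemma additive_finsum:
  assumes add: "\<And>x y. x \<in> carrier C \<Longrightarrow> y \<in> carrier C \<Longrightarrow> f (x \<oplus> y) = f x + (f y :: complex)"
    and e: "\<And>i. i \<in> I \<Longrightarrow> e i \<in> carrier C" and I: "finite I"
  shows "f (\<Oplus>i\<in>I. e i) = (\<Sum>i\<in>I. f (e i))"
proof -
  have "f \<zero> = 0" using add[of \<zero> \<zero>] by simp
  with I e show ?thesis
    by (induction I rule: finite_induct) (auto simp: add finsum_insert finsum_closed Pi_iff)
qed

lemma star_finsum:
  assumes e: "\<And>i. i \<in> I \<Longrightarrow> e i \<in> carrier C" and I: "finite I"
  shows "star C (\<Oplus>i\<in>I. e i) = (\<Oplus>i\<in>I. star C (e i))"
proof -
  have "star C \<zero> = \<zero>" using star_emb[of 0] by simp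
  with I e show ?thesis
    by (induction I rule: finite_induct) (auto simp: finsum_insert star_add star_closed finsum_closed Pi_iff)
qed

definition lincomb :: "('i \<Rightarrow> complex) \<Rightarrow> ('i \<Rightarrow> 'c) \<Rightarrow> 'i set \<Rightarrow> 'c" where
  "lincomb c e I = (\<Oplus>i\<in>I. emb (c i) \<otimes> e i)"

lemma lincomb_closed: "(\<And>i. i \<in> I \<Longrightarrow> e i \<in> carrier C) \<Longrightarrow> lincomb c e I \<in> carrier C"
  unfolding lincomb_def by (intro finsum_closed) auto

lemma character_lincomb:
  assumes "character \<phi>" and e: "\<And>i. i \<in> I \<Longrightarrow> e i \<in> carrier C" and I: "finite I"
  shows "\<phi> (lincomb c e I) = (\<Sum>i\<in>I. c i * \<phi> (e i))"
proof -
  have "\<phi> (lincomb c e I) = (\<Sum>i\<in>I. \<phi> (emb (c i) \<otimes> e i))"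
    unfolding lincomb_def using characterD[OF assms(1)] e I by (intro additive_finsum) auto
  also have "\<dots> = (\<Sum>i\<in>I. c i * \<phi> (e i))"
    using characterD[OF assms(1)] e by (intro sum.cong) auto
  finally show ?thesis .
qed

text \<open>Read from right to left, this folds a double sum with Gram coefficients into the value
  of the state at a square.\<close>

lemma state_lincomb:
  assumes st: "cstar_state C \<tau>" and e: "\<And>i. i \<in> I \<Longrightarrow> e i \<in> carrier C" and I: "finite I"
  shows "\<tau> (star C (lincomb c e I) \<otimes> lincomb c e I) =
    (\<Sum>i\<in>I. \<Sum>j\<in>I. cnj (c i) * c j * \<tau> (star C (e i) \<otimes> e j))"
proof -
  have add: "\<tau> (x \<oplus> y) = \<tau> x + \<tau> y" if "x \<in> carrier C" "y \<in> carrier C" for x y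
    using st that by (auto simp: cstar_state_def)
  have scale: "\<tau> (emb c \<otimes> x) = c * \<tau> x" if "x \<in> carrier C" for x c
    using st that by (auto simp: cstar_state_def emb_mult_eq_smult)
  let ?t = "\<lambda>i. emb (c i) \<otimes> e i"
  have c: "?t i \<in> carrier C" "star C (?t i) \<in> carrier C" "star C (e i) \<in> carrier C" if "i \<in> I" for i using e[OF that] by (auto simp: star_closed)
  have L: "lincomb c e I \<in> carrier C" using e by (rule lincomb_closed)
  have "star C (lincomb c e I) \<otimes> lincomb c e I = (\<Oplus>i\<in>I. star C (?t i)) \<otimes> lincomb c e I"
    using c I by (simp add: lincomb_def star_finsum)
  also have "\<dots> = (\<Oplus>i\<in>I. star C (?t i) \<otimes> lincomb c e I)"
    using c I L by (intro finsum_ldistr) auto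
  also have "\<dots> = (\<Oplus>i\<in>I. \<Oplus>j\<in>I. star C (?t i) \<otimes> ?t j)"
    unfolding lincomb_def using c I by (intro finsum_cong' refl finsum_rdistr) (auto intro!: finsum_closed)
  also have "\<tau> \<dots> = (\<Sum>i\<in>I. \<tau> (\<Oplus>j\<in>I. star C (?t i) \<otimes> ?t j))"
    using c I add by (intro additive_finsum) (auto intro!: finsum_closed)
  also have "\<dots> = (\<Sum>i\<in>I. \<Sum>j\<in>I. \<tau> (star C (?t i) \<otimes> ?t j))"
    using c I add by (intro sum.cong refl additive_finsum) auto
  also have "\<dots> = (\<Sum>i\<in>I. \<Sum>j\<in>I. cnj (c i) * c j * \<tau> (star C (e i) \<otimes> e j))"
  proof (intro sum.cong refl)
    fix i j assume ij: "i \<in> I" "j \<in> I"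
    have "star C (?t i) \<otimes> ?t j = emb (cnj (c i) * c j) \<otimes> (star C (e i) \<otimes> e j)"
      using e[OF ij(1)] e[OF ij(2)] c(3)[OF ij(1)] emb_closed[of "cnj (c i)"] emb_closed[of "c j"]
      by (simp add: star_mult' star_emb emb_mult m_ac)
    then show "\<tau> (star C (?t i) \<otimes> ?t j) = cnj (c i) * c j * \<tau> (star C (e i) \<otimes> e j)"
      using e[OF ij(2)] c(3)[OF ij(1)] scale by simp
  qed
  finally show ?thesis .
qed

end

subsection \<open>Correlations and homomorphisms\<close>

lemma loc_hom_imp_antisystem_hom:
  fixes U :: "(complex^('x::finite \<times> 'x)) set" and V :: "(complex^('a::finite \<times> 'a)) set"
  assumes U: "vec.subspace U" and V: "vec.subspace V" and loc: "loc_hom TYPE('u) U V"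
  shows "antisystem_hom (antisystem_of U) (antisystem_of V)"
proof -
  define P Q where "P = proj_mat U" and "Q = mat 1 - proj_mat V"
  obtain \<Gamma> where qns: "QNS_correlation \<Gamma>" and lt: "locally_tracial TYPE('u) \<Gamma>"
    and "dual_pairing (\<Gamma> (proj_mat U)) (orth_proj dual_inner (annihilator V)) = 0"
    using loc by (auto simp: loc_hom_def)
  then have zero: "trace (\<Gamma> P ** Q) = 0" by (simp add: dual_pairing_annihilator[OF V] P_def Q_def)
  obtain C :: "'u normed_star_algebra" and \<tau> and g :: "'x \<Rightarrow> 'x \<Rightarrow> 'a \<Rightarrow> 'a \<Rightarrow> 'u"
    where C: "abelian_cstar_algebra C" and st: "cstar_state C \<tau>" and g: "positive_element C g"
      and tr: "\<And>x x'. (\<Oplus>\<^bsub>C\<^esub>a\<in>UNIV. g x x' a a) = (if x = x' then \<one>\<^bsub>C\<^esub> else \<zero>\<^bsub>C\<^esub>)"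
      and G: "\<And>x x' y y'. \<Gamma> (mat_unit x x' \<otimes>\<^sub>m mat_unit y y') =
           (\<Sum>a\<in>UNIV. \<Sum>a'\<in>UNIV. \<Sum>b\<in>UNIV. \<Sum>b'\<in>UNIV.
              \<tau> (g x x' a a' \<otimes>\<^bsub>C\<^esub> g y' y b' b) *\<^sub>m (mat_unit a a' \<otimes>\<^sub>m mat_unit b b'))"
    using lt unfolding locally_tracial_def by blast
  interpret abelian_cstar_algebra C by (rule C)
  obtain h0 :: "'x \<Rightarrow> 'x \<Rightarrow> 'a \<Rightarrow> 'a \<Rightarrow> 'u" where h0: "\<forall>x x' a a'. h0 x x' a a' \<in> carrier C"
    and gh0: "\<forall>x x' a a'. g x x' a a' =
      (\<Oplus>\<^bsub>C\<^esub>p\<in>UNIV. star C (h0 (fst p) x (snd p) a) \<otimes>\<^bsub>C\<^esub> h0 (fst p) x' (snd p) a')"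
    using g unfolding positive_element_def by blast
  define h where "h p x a = h0 (fst p) x (snd p) a" for p x a
  have h [simp, intro]: "h p x a \<in> carrier C" "star C (h p x a) \<in> carrier C" for p x a
    using h0 by (auto simp: h_def star_closed)
  have gh: "g x x' a a' = (\<Oplus>\<^bsub>C\<^esub>p\<in>UNIV. star C (h p x a) \<otimes>\<^bsub>C\<^esub> h p x' a')" for x x' a a'
    by (simp add: gh0 h_def)
  have gc [simp]: "g x x' a a' \<in> carrier C" for x x' a a'
    unfolding gh by (intro finsum_closed) auto
  obtain \<phi> where phi: "character \<phi>" and ker: "\<And>x. x \<in> carrier C \<Longrightarrow> \<tau> (star C x \<otimes>\<^bsub>C\<^esub> x) = 0 \<Longrightarrow> \<phi> x = 0"
    using state_character[OF st] by blast
  note phiD = characterD[OF phi]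
  have phi01: "\<phi> \<zero>\<^bsub>C\<^esub> = 0" "\<phi> \<one>\<^bsub>C\<^esub> = 1" using phiD(4)[of 0] phiD(4)[of 1] by simp_all
  have add: "\<tau> (x \<oplus>\<^bsub>C\<^esub> y) = \<tau> x + \<tau> y" if "x \<in> carrier C" "y \<in> carrier C" for x y
    using st that by (auto simp: cstar_state_def)
  have pos: "\<tau> (star C x \<otimes>\<^bsub>C\<^esub> x) \<in> \<real>\<^sub>\<ge>\<^sub>0" if "x \<in> carrier C" for x
    using st that by (auto simp: cstar_state_def)

  \<comment> \<open>Applying the character to \<open>g = h^* h\<close> gives entries with the
    conjugate on the first factor, whereas a Choi matrix has it on the second; the conjugate in
    \<open>M\<close> repairs this.\<close>
  define M :: "'x \<times> 'a \<Rightarrow> complex^'x^'a" where "M p = (\<chi> a x. cnj (\<phi> (h p x a)))" for p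
  have norm_M: "kraus_normalized UNIV M"
    unfolding kraus_normalized_def
  proof (intro allI)
    fix x x'
    have "(\<Sum>p\<in>UNIV. \<Sum>a\<in>UNIV. M p $ a $ x * cnj (M p $ a $ x')) =
      (\<Sum>a\<in>UNIV. \<Sum>p\<in>UNIV. M p $ a $ x * cnj (M p $ a $ x'))" by (rule sum.swap)
    also have "\<dots> = (\<Sum>a\<in>UNIV. \<phi> (g x x' a a))"
    proof (intro sum.cong refl)
      fix a
      have "\<phi> (g x x' a a) = (\<Sum>p\<in>UNIV. \<phi> (star C (h p x a) \<otimes>\<^bsub>C\<^esub> h p x' a))"
        unfolding gh by (intro additive_finsum phiD) auto
      then show "(\<Sum>p\<in>UNIV. M p $ a $ x * cnj (M p $ a $ x')) = \<phi> (g x x' a a)"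
        by (simp add: M_def phiD)
    qed
    also have "\<dots> = \<phi> (\<Oplus>\<^bsub>C\<^esub>a\<in>UNIV. g x x' a a)"
      by (intro additive_finsum[symmetric] phiD) auto
    also have "\<dots> = (if x = x' then 1 else 0)" by (simp add: tr phi01)
    finally show "(\<Sum>p\<in>UNIV. \<Sum>a\<in>UNIV. M p $ a $ x * cnj (M p $ a $ x')) = (if x = x' then 1 else 0)" .
  qed

  \<comment> \<open>\<open>e\<close> pairs an entry of \<open>h\<close> from the first copy of
    \<open>g\<close> with the adjoint of one from the second, so that \<open>e^* e'\<close> collects
    the four factors of a product of two entries of \<open>g\<close>.\<close>
  define e where "e n i = h (fst n) (fst (fst i)) (fst (snd i)) \<otimes>\<^bsub>C\<^esub> star C (h (snd n) (snd (fst i)) (snd (snd i)))"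
    for n :: "('x \<times> 'a) \<times> ('x \<times> 'a)" and i :: "('x \<times> 'x) \<times> ('a \<times> 'a)"
  have e [simp, intro]: "e n i \<in> carrier C" "star C (e n i) \<in> carrier C" for n i
    by (auto simp: e_def star_closed)
  have tau_g: "\<tau> (g (fst s) (fst s') (fst t) (fst t') \<otimes>\<^bsub>C\<^esub> g (snd s') (snd s) (snd t') (snd t)) =
     (\<Sum>n\<in>UNIV. \<tau> (star C (e n (s, t)) \<otimes>\<^bsub>C\<^esub> e n (s', t')))" for s s' t t'
  proof -
    let ?l = "\<lambda>p. star C (h p (fst s) (fst t)) \<otimes>\<^bsub>C\<^esub> h p (fst s') (fst t')"
    let ?r = "\<lambda>q. star C (h q (snd s') (snd t')) \<otimes>\<^bsub>C\<^esub> h q (snd s) (snd t)"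
    let ?gr = "g (snd s') (snd s) (snd t') (snd t)"
    have "\<tau> (g (fst s) (fst s') (fst t) (fst t') \<otimes>\<^bsub>C\<^esub> ?gr) = \<tau> (\<Oplus>\<^bsub>C\<^esub>p\<in>UNIV. ?l p \<otimes>\<^bsub>C\<^esub> ?gr)"
      unfolding gh[of "fst s"] by (subst finsum_ldistr) auto
    also have "\<dots> = (\<Sum>p\<in>UNIV. \<tau> (?l p \<otimes>\<^bsub>C\<^esub> ?gr))"
      by (intro additive_finsum add) auto
    also have "\<dots> = (\<Sum>p\<in>UNIV. \<tau> (\<Oplus>\<^bsub>C\<^esub>q\<in>UNIV. ?l p \<otimes>\<^bsub>C\<^esub> ?r q))"
      unfolding gh by (subst finsum_rdistr) auto
    also have "\<dots> = (\<Sum>p\<in>UNIV. \<Sum>q\<in>UNIV. \<tau> (?l p \<otimes>\<^bsub>C\<^esub> ?r q))"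
      by (intro sum.cong refl additive_finsum add) auto
    also have "\<dots> = (\<Sum>p\<in>UNIV. \<Sum>q\<in>UNIV. \<tau> (star C (e (p, q) (s, t)) \<otimes>\<^bsub>C\<^esub> e (p, q) (s', t')))"
      by (simp add: e_def star_mult' star_star star_closed m_ac)
    finally show ?thesis by (simp add: sum_UNIV_prod[of "\<lambda>n. \<tau> (star C (e n (s, t)) \<otimes>\<^bsub>C\<^esub> e n (s', t'))"])
  qed
  have lin: "mat_linear \<Gamma>" using qns by (simp add: QNS_correlation_def quantum_channel_def completely_positive_def)
  have Gamma: "\<Gamma> P $ t $ t' = (\<Sum>s\<in>UNIV. \<Sum>s'\<in>UNIV. P $ s $ s' * (\<Sum>n\<in>UNIV. \<tau> (star C (e n (s, t)) \<otimes>\<^bsub>C\<^esub> e n (s', t'))))" for t t'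
  proof -
    have "\<Gamma> P $ t $ t' = (\<Sum>x\<in>UNIV. \<Sum>x'\<in>UNIV. \<Sum>y\<in>UNIV. \<Sum>y'\<in>UNIV.
       P $ (x, y) $ (x', y') * \<tau> (g x x' (fst t) (fst t') \<otimes>\<^bsub>C\<^esub> g y' y (snd t') (snd t)))"
      by (subst mat_linear_expansion[OF lin]) (simp only: G sum_mat_unit_tensor, simp add: mat_scale_def)
    also have "\<dots> = (\<Sum>x\<in>UNIV. \<Sum>y\<in>UNIV. \<Sum>x'\<in>UNIV. \<Sum>y'\<in>UNIV.
       P $ (x, y) $ (x', y') * \<tau> (g x x' (fst t) (fst t') \<otimes>\<^bsub>C\<^esub> g y' y (snd t') (snd t)))"
      by (intro sum.cong refl sum.swap)
    also have "\<dots> = (\<Sum>s\<in>UNIV. \<Sum>s'\<in>UNIV. P $ s $ s' * \<tau> (g (fst s) (fst s') (fst t) (fst t') \<otimes>\<^bsub>C\<^esub> g (snd s') (snd s) (snd t') (snd t)))"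
      by (simp add: sum_UNIV_prod[where 'm = 'x and 'n = 'x])
    finally show ?thesis by (simp only: tau_g)
  qed
  have PP: "P $ s $ s' = (\<Sum>k\<in>UNIV. P $ s $ k * cnj (P $ s' $ k))" for s s'
  proof -
    have "P = P ** adj P" by (simp add: P_def proj_mat_idem[OF U] proj_mat_hermitian[OF U])
    then have "P $ s $ s' = (P ** adj P) $ s $ s'" by simp
    then show ?thesis by (simp add: matrix_matrix_mult_def adj_def)
  qed
  have adjQ: "adj Q = Q"
  proof -
    have "adj Q = adj (mat 1) - adj (proj_mat V)" by (simp add: Q_def adj_def vec_eq_iff)
    then show ?thesis by (simp add: Q_def proj_mat_hermitian[OF V]) (simp add: adj_def mat_def vec_eq_iff)
  qed
  have "Q ** Q = Q"
    by (simp add: Q_def matrix_eq matrix_vector_mult_diff_rdistrib matrix_vector_mult_diff_distrib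
       proj_mat_idem[OF V] flip: matrix_vector_mul_assoc) (simp add: matrix_vector_mul_assoc proj_mat_idem[OF V])
  then have QQ: "Q $ s $ s' = (\<Sum>k\<in>UNIV. Q $ s $ k * cnj (Q $ s' $ k))" for s s'
  proof -
    have "Q = Q ** adj Q" by (simp add: adjQ \<open>Q ** Q = Q\<close>)
    then have "Q $ s $ s' = (Q ** adj Q) $ s $ s'" by simp
    then show ?thesis by (simp add: matrix_matrix_mult_def adj_def)
  qed
  \<comment> \<open>Writing the projections as \<open>P P^*\<close> and \<open>Q Q^*\<close> makes
    the coefficients of the trace a Gram matrix, with one vector \<open>c m\<close> for each pair of
    columns.\<close>
  define c where "c m i = cnj (P $ fst i $ fst m) * Q $ snd i $ snd m" for m i :: "('x \<times> 'x) \<times> ('a \<times> 'a)"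
  have PQ: "P $ s $ s' * Q $ t' $ t = (\<Sum>m\<in>UNIV. cnj (c m (s, t)) * c m (s', t'))" for s s' t t'
  proof -
    have "P $ s $ s' * Q $ t' $ t = (\<Sum>k\<in>UNIV. \<Sum>l\<in>UNIV. (P $ s $ k * cnj (P $ s' $ k)) * (Q $ t' $ l * cnj (Q $ t $ l)))"
      by (subst PP, subst QQ) (rule sum_product)
    then show ?thesis by (simp add: c_def sum_UNIV_prod[where 'm = "'x \<times> 'x" and 'n = "'a \<times> 'a"] mult_ac)
  qed
  define K where "K m n = lincomb (c m) (e n) UNIV" for m n
  have Kc: "K m n \<in> carrier C" for m n unfolding K_def by (intro lincomb_closed) auto
  \<comment> \<open>The reordering brings \<open>s\<close> next to \<open>t\<close> and
    \<open>s'\<close> next to \<open>t'\<close>, so that each pair becomes one index of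
    \<open>e\<close>.\<close>
  have "0 = (\<Sum>t\<in>UNIV. \<Sum>t'\<in>UNIV. \<Sum>s\<in>UNIV. \<Sum>s'\<in>UNIV. (P $ s $ s' * Q $ t' $ t) * (\<Sum>n\<in>UNIV. \<tau> (star C (e n (s, t)) \<otimes>\<^bsub>C\<^esub> e n (s', t'))))"
    unfolding zero[symmetric] by (simp only: trace_def matrix_matrix_mult_def vec_lambda_beta Gamma sum_distrib_right) (simp add: mult_ac)
  also have "\<dots> = (\<Sum>t\<in>UNIV. \<Sum>s\<in>UNIV. \<Sum>t'\<in>UNIV. \<Sum>s'\<in>UNIV. (P $ s $ s' * Q $ t' $ t) * (\<Sum>n\<in>UNIV. \<tau> (star C (e n (s, t)) \<otimes>\<^bsub>C\<^esub> e n (s', t'))))"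
    by (intro sum.cong refl sum.swap)
  also have "\<dots> = (\<Sum>s\<in>UNIV. \<Sum>t\<in>UNIV. \<Sum>t'\<in>UNIV. \<Sum>s'\<in>UNIV. (P $ s $ s' * Q $ t' $ t) * (\<Sum>n\<in>UNIV. \<tau> (star C (e n (s, t)) \<otimes>\<^bsub>C\<^esub> e n (s', t'))))"
    by (rule sum.swap)
  also have "\<dots> = (\<Sum>s\<in>UNIV. \<Sum>t\<in>UNIV. \<Sum>s'\<in>UNIV. \<Sum>t'\<in>UNIV. (P $ s $ s' * Q $ t' $ t) * (\<Sum>n\<in>UNIV. \<tau> (star C (e n (s, t)) \<otimes>\<^bsub>C\<^esub> e n (s', t'))))"
    by (intro sum.cong refl sum.swap)
  also have "\<dots> = (\<Sum>i\<in>UNIV. \<Sum>j\<in>UNIV. (\<Sum>m\<in>UNIV. cnj (c m i) * c m j) * (\<Sum>n\<in>UNIV. \<tau> (star C (e n i) \<otimes>\<^bsub>C\<^esub> e n j)))"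
    by (simp add: PQ sum_UNIV_prod[where 'm = "'x \<times> 'x" and 'n = "'a \<times> 'a", of "\<lambda>i. \<Sum>j\<in>UNIV. _ i j"]
      sum_UNIV_prod[where 'm = "'x \<times> 'x" and 'n = "'a \<times> 'a", of "\<lambda>j. (\<Sum>m\<in>UNIV. _ m j) * _ j"])
  also have "\<dots> = (\<Sum>i\<in>UNIV. \<Sum>j\<in>UNIV. \<Sum>r\<in>UNIV. cnj (c (fst r) i) * c (fst r) j * \<tau> (star C (e (snd r) i) \<otimes>\<^bsub>C\<^esub> e (snd r) j))"
    by (simp add: sum_product sum.cartesian_product split_def)
  also have "\<dots> = (\<Sum>i\<in>UNIV. \<Sum>r\<in>UNIV. \<Sum>j\<in>UNIV. cnj (c (fst r) i) * c (fst r) j * \<tau> (star C (e (snd r) i) \<otimes>\<^bsub>C\<^esub> e (snd r) j))"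
    by (intro sum.cong refl sum.swap)
  also have "\<dots> = (\<Sum>r\<in>UNIV. \<Sum>i\<in>UNIV. \<Sum>j\<in>UNIV. cnj (c (fst r) i) * c (fst r) j * \<tau> (star C (e (snd r) i) \<otimes>\<^bsub>C\<^esub> e (snd r) j))"
    by (rule sum.swap)
  also have "\<dots> = (\<Sum>r\<in>UNIV. \<tau> (star C (K (fst r) (snd r)) \<otimes>\<^bsub>C\<^esub> K (fst r) (snd r)))"
    unfolding K_def by (intro sum.cong refl state_lincomb[OF st, symmetric]) auto
  finally have sum0: "(\<Sum>r\<in>UNIV. \<tau> (star C (K (fst r) (snd r)) \<otimes>\<^bsub>C\<^esub> K (fst r) (snd r))) = 0" ..
  \<comment> \<open>All summands of \<open>sum0\<close> are nonnegative, so each vanishes and the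
    character annihilates every \<open>K m n\<close>.\<close>
  have "\<phi> (K m n) = 0" for m n
    using sum_nonneg_Reals_eq_0[OF _ _ sum0, of "(m, n)"] by (intro ker Kc) (simp add: pos[OF Kc])
  then have K0: "(\<Sum>i\<in>UNIV. c m i * \<phi> (e n i)) = 0" for m n
    unfolding K_def by (subst (asm) character_lincomb[OF phi]) auto
  \<comment> \<open>Entry (l, k) of this product is the conjugate of the value of the character at
    \<open>K (k, l) (p, q)\<close>.\<close>
  have QMP: "Q ** conj_tensor (M p) (M q) ** P = 0" for p q
  proof -
    have "(Q ** conj_tensor (M p) (M q) ** P) $ l $ k = 0" for l k
    proof -
      have Qlt: "Q $ l $ t = cnj (Q $ t $ l)" for t
        by (subst adjQ[symmetric]) (simp add: adj_def)
      have "(Q ** conj_tensor (M p) (M q) ** P) $ l $ k =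
         (\<Sum>s\<in>UNIV. \<Sum>t\<in>UNIV. cnj (c (k, l) (s, t) * \<phi> (e (p, q) (s, t))))"
        by (simp add: matrix_matrix_mult_def c_def e_def conj_tensor_def M_def phiD Qlt
            sum_distrib_right sum_distrib_left mult_ac)
      also have "\<dots> = cnj (\<Sum>i\<in>UNIV. c (k, l) i * \<phi> (e (p, q) i))"
        by (simp add: sum_UNIV_prod[where 'm = "'x \<times> 'x" and 'n = "'a \<times> 'a"])
      finally show ?thesis by (simp add: K0)
    qed
    then show ?thesis by (simp add: vec_eq_iff)
  qed
  \<comment> \<open>\<open>antisystem_hom\<close> numbers its Kraus operators, while
    \<open>M\<close> is indexed by pairs.\<close>
  obtain b where b: "bij_betw b {0..<card (UNIV :: ('x \<times> 'a) set)} (UNIV :: ('x \<times> 'a) set)"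
    using ex_bij_betw_nat_finite[of "UNIV :: ('x \<times> 'a) set"] by auto
  then have b: "bij_betw b {..<card (UNIV :: ('x \<times> 'a) set)} (UNIV :: ('x \<times> 'a) set)"
    by (simp add: atLeast0LessThan)
  have "kraus_map UNIV M T = (\<Sum>i<card (UNIV :: ('x \<times> 'a) set). M (b i) ** T ** adj (M (b i)))" for T
    unfolding kraus_map_def by (rule sum.reindex_bij_betw[OF b, symmetric])
  moreover have "(*v) (conj_mat (M (b j))) \<circ> S \<circ> dual_op (M (b i)) \<in> antisystem_of V"
    if "S \<in> antisystem_of U" for i j S
    using maps_into_iff[OF U V, of "conj_tensor (M (b i)) (M (b j))"] QMP that
    unfolding P_def Q_def antisystem_of_maps_iff[symmetric] by blast
  ultimately show ?thesis
    unfolding antisystem_hom_def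
    using quantum_channel_kraus_map[OF norm_M]
    by (intro exI[of _ "kraus_map UNIV M"] exI[of _ "card (UNIV :: ('x \<times> 'a) set)"] exI[of _ "\<lambda>i. M (b i)"]) blast
qed

text \<open>The complex numbers carried by the right summand, since the theorem draws its carriers
  from \<open>'c + complex\<close>.\<close>

definition complex_algebra :: "('c + complex) normed_star_algebra" where
  "complex_algebra = \<lparr>carrier = range Inr, mult = (\<lambda>x y. Inr (projr x * projr y)), one = Inr 1,
     zero = Inr 0, add = (\<lambda>x y. Inr (projr x + projr y)), smult = (\<lambda>c x. Inr (c * projr x)),
     star = (\<lambda>x. Inr (cnj (projr x))), nrm = (\<lambda>x. cmod (projr x))\<rparr>"

lemma complex_algebra_simps [simp]:
  "carrier complex_algebra = range Inr"
  "x \<otimes>\<^bsub>complex_algebra\<^esub> y = Inr (projr x * projr y)"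
  "\<one>\<^bsub>complex_algebra\<^esub> = Inr 1"
  "\<zero>\<^bsub>complex_algebra\<^esub> = Inr 0"
  "x \<oplus>\<^bsub>complex_algebra\<^esub> y = Inr (projr x + projr y)"
  "c \<odot>\<^bsub>complex_algebra\<^esub> x = Inr (c * projr x)"
  "star complex_algebra x = Inr (cnj (projr x))"
  "nrm complex_algebra x = cmod (projr x)"
  by (simp_all add: complex_algebra_def)

lemma complex_algebra_abelian_group: "abelian_group complex_algebra"
proof (rule abelian_groupI)
  fix x :: "'c + complex" assume "x \<in> carrier complex_algebra"
  then show "\<exists>y\<in>carrier complex_algebra. y \<oplus>\<^bsub>complex_algebra\<^esub> x = \<zero>\<^bsub>complex_algebra\<^esub>"
    by (intro bexI[of _ "Inr (- projr x)"]) auto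
qed auto

text \<open>The ring subtraction goes through an additive inverse given by a description;
  identifying it reduces the completeness axiom to completeness of the complex numbers.\<close>

lemma complex_algebra_minus [simp]:
  "Inr a \<ominus>\<^bsub>complex_algebra\<^esub> Inr b = (Inr (a - b) :: 'c + complex)"
proof -
  interpret abelian_group "complex_algebra :: ('c + complex) normed_star_algebra" by (rule complex_algebra_abelian_group)
  have "\<ominus>\<^bsub>complex_algebra\<^esub> Inr b = (Inr (- b) :: 'c + complex)" by (rule minus_equality) auto
  then show ?thesis by (simp add: a_minus_def)
qed

lemma abelian_cstar_algebra_complex_algebra: "abelian_cstar_algebra complex_algebra"
proof -
  interpret G: abelian_group complex_algebra by (rule complex_algebra_abelian_group)
  have ring: "ring complex_algebra"
    by (intro ringI G.abelian_group_axioms monoidI) (auto simp: algebra_simps)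
  have "cring complex_field"
  proof (intro cringI abelian_groupI comm_monoidI)
    fix x assume "x \<in> carrier complex_field"
    then show "\<exists>y\<in>carrier complex_field. y \<oplus>\<^bsub>complex_field\<^esub> x = \<zero>\<^bsub>complex_field\<^esub>"
      by (intro bexI[of _ "- x"]) (auto simp: complex_field_def)
  qed (auto simp: complex_field_def algebra_simps)
  then have module: "Module.module complex_field complex_algebra"
    by (intro moduleI G.abelian_group_axioms) (auto simp: complex_field_def algebra_simps)
  show ?thesis
  proof (intro abelian_cstar_algebra.intro unital_cstar_algebra.intro module ring
      unital_cstar_algebra_axioms.intro abelian_cstar_algebra_axioms.intro)
    fix s :: "nat \<Rightarrow> 'c + complex"
    assume s: "range s \<subseteq> carrier complex_algebra"
      and cauchy: "\<forall>\<epsilon>>0. \<exists>N. \<forall>m\<ge>N. \<forall>n\<ge>N. nrm complex_algebra (s m \<ominus>\<^bsub>complex_algebra\<^esub> s n) < \<epsilon>"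
    define z where "z n = projr (s n)" for n
    have sz: "s n = Inr (z n)" for n
      using range_subsetD[OF s, of n] by (auto simp: z_def)
    have "Cauchy z" unfolding Cauchy_def dist_norm using cauchy by (simp add: sz)
    then obtain l where "z \<longlonglongrightarrow> l" by (auto simp: Cauchy_convergent_iff convergent_def)
    then have "(\<lambda>n. cmod (z n - l)) \<longlonglongrightarrow> 0" by (simp add: LIM_zero tendsto_norm_zero)
    then show "\<exists>x\<in>carrier complex_algebra. (\<lambda>n. nrm complex_algebra (s n \<ominus>\<^bsub>complex_algebra\<^esub> x)) \<longlonglongrightarrow> 0"
      by (intro bexI[of _ "Inr l"]) (simp_all add: sz)
  qed (auto simp: norm_mult norm_triangle_ineq algebra_simps power2_eq_square)
qed

lemma antisystem_hom_imp_loc_hom: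
  fixes U :: "(complex^('x::finite \<times> 'x)) set" and V :: "(complex^('a::finite \<times> 'a)) set"
  assumes U: "vec.subspace U" and V: "vec.subspace V"
    and hom: "antisystem_hom (antisystem_of U) (antisystem_of V)"
  shows "loc_hom TYPE('c + complex) U V"
proof -
  obtain F :: "complex^'x^'x \<Rightarrow> complex^'a^'a" and m and M :: "nat \<Rightarrow> complex^'x^'a"
    where F: "quantum_channel F" and FM: "\<forall>T. F T = (\<Sum>i<m. M i ** T ** adj (M i))"
      and MUV: "\<forall>i<m. \<forall>j<m. \<forall>S\<in>antisystem_of U. (*v) (conj_mat (M j)) \<circ> S \<circ> dual_op (M i) \<in> antisystem_of V"
    using hom unfolding antisystem_hom_def by blast
  have "F = kraus_map {..<m} M" using FM by (simp add: fun_eq_iff kraus_map_def)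
  with F have norm: "kraus_normalized {..<m} M"
    by (simp add: kraus_normalized_iff_trace quantum_channel_def)
  define \<Gamma> where "\<Gamma> = kraus_map ({..<m} \<times> {..<m}) (\<lambda>(i, j). conj_tensor (M i) (M j))"
  define P Q where "P = proj_mat U" and "Q = mat 1 - proj_mat V"
  have QMP: "Q ** conj_tensor (M i) (M j) ** P = 0" if "i < m" "j < m" for i j
    using MUV that maps_into_iff[OF U V] unfolding P_def Q_def antisystem_of_maps_iff by blast
  have "dual_pairing (\<Gamma> P) (orth_proj dual_inner (annihilator V)) = trace (\<Gamma> P ** Q)"
    unfolding Q_def by (rule dual_pairing_annihilator[OF V])
  \<comment> \<open>With \<open>Q\<close> on the left, every Kraus summand contains the factor that
    vanishes by \<open>QMP\<close>.\<close>
  also have "\<dots> = trace (Q ** \<Gamma> P)" by (rule trace_mul_sym)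
  also have "Q ** \<Gamma> P = (\<Sum>(i, j)\<in>{..<m} \<times> {..<m}. (Q ** conj_tensor (M i) (M j) ** P) ** adj (conj_tensor (M i) (M j)))"
  proof -
    have "Q ** (\<Sum>k\<in>I. A k) = (\<Sum>k\<in>I. Q ** A k)" for I and A :: "nat \<times> nat \<Rightarrow> complex^('a \<times> 'a)^('a \<times> 'a)"
      by (simp add: vec_eq_iff matrix_matrix_mult_def sum_distrib_left) (auto intro: sum.swap)
    then show ?thesis by (simp add: \<Gamma>_def kraus_map_def matrix_mul_assoc split_def)
  qed
  also have "\<dots> = 0" by (intro sum.neutral) (clarsimp simp: QMP)
  finally have zero: "dual_pairing (\<Gamma> P) (orth_proj dual_inner (annihilator V)) = 0"
    by (simp add: trace_def)

  let ?C = "complex_algebra :: ('c + complex) normed_star_algebra"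
  interpret abelian_cstar_algebra ?C by (rule abelian_cstar_algebra_complex_algebra)
  have fs: "(\<Oplus>\<^bsub>?C\<^esub>i\<in>I. Inr (f i)) = Inr (\<Sum>i\<in>I. f i)" if "finite I" for I :: "'i set" and f
    using that
  proof induction
    case (insert i I)
    then show ?case by (subst finsum_insert) auto
  qed simp
  \<comment> \<open>\<open>positive_element\<close> wants a square \<open>h\<close> over pairs,
    whereas the Kraus family supplies \<open>m\<close> vectors; the factorization produces exactly
    one row for each pair.\<close>
  obtain h :: "'x \<times> 'a \<Rightarrow> 'x \<times> 'a \<Rightarrow> complex" where "\<forall>s\<in>UNIV. \<forall>t\<in>UNIV.
      (\<Sum>i<m. M i $ snd s $ fst s * cnj (M i $ snd t $ fst t)) = (\<Sum>p\<in>UNIV. cnj (h p s) * h p t)"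
    using gram_matrix_factorization[OF finite, where v = "\<lambda>i s. M i $ snd s $ fst s"] by blast
  then have h: "(\<Sum>i<m. M i $ snd s $ fst s * cnj (M i $ snd t $ fst t)) = (\<Sum>p\<in>UNIV. cnj (h p s) * h p t)"
    for s t by blast
  define G where "G x x' a a' = (\<Sum>i<m. M i $ a $ x * cnj (M i $ a' $ x'))" for x x' a a'
  define g :: "'x \<Rightarrow> 'x \<Rightarrow> 'a \<Rightarrow> 'a \<Rightarrow> 'c + complex" where "g x x' a a' = Inr (G x x' a a')" for x x' a a'
  have "cstar_state ?C projr"
    by (auto simp: cstar_state_def complex_nonneg_Reals_iff)
  moreover have "positive_element ?C g"
    unfolding positive_element_def
    by (intro exI[of _ "\<lambda>x x' a a'. Inr (h (x, a) (x', a'))"])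
      (simp add: fs g_def G_def h[of "(_, _)" "(_, _)", simplified])
  moreover have "(\<Oplus>\<^bsub>?C\<^esub>a\<in>UNIV. g x x' a a) = (if x = x' then \<one>\<^bsub>?C\<^esub> else \<zero>\<^bsub>?C\<^esub>)" for x x'
  proof -
    have "(\<Sum>a\<in>UNIV. G x x' a a) = (if x = x' then 1 else 0)"
      using norm unfolding kraus_normalized_def G_def by (subst sum.swap) blast
    then show ?thesis by (simp add: g_def fs)
  qed
  \<comment> \<open>The second tensor factor is the channel with conjugated Kraus operators; its
    Choi entries are those of \<open>G\<close> with both index pairs swapped, which is the order
    \<open>g y' y b' b\<close>.\<close>
  moreover have "\<Gamma> (mat_unit x x' \<otimes>\<^sub>m mat_unit y y') = (\<Sum>a\<in>UNIV. \<Sum>a'\<in>UNIV. \<Sum>b\<in>UNIV. \<Sum>b'\<in>UNIV.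
      projr (g x x' a a' \<otimes>\<^bsub>?C\<^esub> g y' y b' b) *\<^sub>m (mat_unit a a' \<otimes>\<^sub>m mat_unit b b'))" for x x' y y'
    unfolding sum_mat_unit_tensor \<Gamma>_def kraus_map_tensor
    by (simp add: vec_eq_iff mat_tensor_def kraus_map_mat_unit g_def G_def conj_mat_def adj_def transpose_def mult.commute)
  ultimately have "locally_tracial TYPE('c + complex) \<Gamma>"
    unfolding locally_tracial_def using abelian_cstar_algebra_complex_algebra by blast
  moreover have "QNS_correlation \<Gamma>" unfolding \<Gamma>_def by (rule QNS_correlation_kraus_map[OF norm norm])
  ultimately show ?thesis using zero unfolding loc_hom_def P_def by blast
qed

theorem proposition10p10:
  fixes U :: "(complex^('x::finite \<times> 'x)) set"
    and V :: "(complex^('a::finite \<times> 'a)) set"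
  assumes "symmetric_skew_subspace U" and "symmetric_skew_subspace V"
  shows "loc_hom TYPE('c + complex) U V \<longleftrightarrow>
    antisystem_hom (antisystem_of U) (antisystem_of V)"
  using assms unfolding symmetric_skew_subspace_def
  by (blast intro: loc_hom_imp_antisystem_hom antisystem_hom_imp_loc_hom)

end
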